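(* Let $d\ge3$ and let $\mathbf X=(X_t)_{t\ge0}$ be an isotropic unimodal Lévy process in $\mathbb R^d$ with Lévy–Khintchine exponent $\psi$ and potential measure $G$. Assume that $\psi\in\mathcal R^\infty_\alpha$ for some $\alpha\in[0,2]$. Then $$\lim_{r\to0^+}\psi(r^{-1})\,G(\{x:|x|\le r\})=\tilde{\mathcal C}_{d,\alpha},\qquad\text{where}\qquad \tilde{\mathcal C}_{d,\alpha}=2^{-\alpha}\frac{\Gamma((d-\alpha)/2)}{\Gamma(d/2)\,\Gamma(1+\alpha/2)}.$$
   Context: An isotropic Lévy process in $\mathbb R^d$ is a Lévy process $\mathbf X=(X_t)_{t\ge0}$ with $X_0=0$ a.s. such that each $X_t$ has a rotationally invariant distribution $p(t,dx)$. Its Lévy–Khintchine exponent $\psi$ is defined by $\int_{\mathbb R^d}e^{i\langle\xi,x\rangle}p(t,dx)=e^{-t\psi(\xi)}$, with $\psi(\xi)=\int_{\mathbb R^d}(1-\cos\langle\xi,x\rangle)\,\nu(dx)+\eta|\xi|^2$, where $\eta\ge0$ and $\nu$ is a rotationally invariant Lévy measure. The function $\psi$ is radial and one writes $\psi(r)=\psi(\xi)$ for $r=|\xi|$. A Borel measure is isotropic unimodal if it is absolutely continuous on $\mathbb R^d\setminus\{0\}$ with a radial, radially non-increasing density. $\mathbf X$ is isotropic unimodal if $p(t,dx)$ is isotropic unimodal for every $t>0$. The potential measure is $G(A)=\int_0^\infty\mathbb P(X_t\in A)\,dt$ for Borel $A\subset\mathbb R^d$ (the process is transient since $d\ge3$).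 Regular variation: a function $f$, positive on some $[x_0,+\infty)$ with $x_0>0$, is in $\mathcal R^\infty_\alpha$ (regularly varying of index $\alpha$ at infinity) if $f(\lambda x)/f(x)\to\lambda^\alpha$ as $x\to+\infty$ for each $\lambda>0$. The condition $\psi\in\mathcal R^\infty_\alpha$ refers to $r\mapsto\psi(r)$. *)

theory Defs
  imports "HOL-Probability.Probability"
begin

text \<open>
  Rotation invariance means invariance under every orthogonal map. The condition on
  \<open>sets\<close> says that \<open>\<mu>\<close> is a Borel measure; it is needed because \<open>distr\<close> fixes the
  \<open>\<sigma>\<close>-algebra of the image measure.
\<close>

definition rotation_invariant :: "'a::euclidean_space measure \<Rightarrow> bool" where
  "rotation_invariant \<mu> \<longleftrightarrow>
     sets \<mu> = sets borel \<and>
     (\<forall>U. orthogonal_transformation U \<longrightarrow> distr \<mu> borel U = \<mu>)"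

definition levy_measure :: "'a::euclidean_space measure \<Rightarrow> bool" where
  "levy_measure \<nu> \<longleftrightarrow>
     sets \<nu> = sets borel \<and> emeasure \<nu> {0} = 0 \<and>
     (\<integral>\<^sup>+x. ennreal (min 1 ((norm x)\<^sup>2)) \<partial>\<nu>) < \<infinity>"

text \<open>The origin may carry an atom, and the density may be unbounded near it.\<close>

definition isotropic_unimodal :: "'a::euclidean_space measure \<Rightarrow> bool" where
  "isotropic_unimodal \<mu> \<longleftrightarrow>
     sets \<mu> = sets borel \<and>
     (\<exists>f :: real \<Rightarrow> real. f \<in> borel_measurable borel \<and>
        (\<forall>r>0. 0 \<le> f r) \<and> antimono_on {0<..} f \<and>
        (\<forall>A \<in> sets borel. 0 \<notin> A \<longrightarrow>
           emeasure \<mu> A = emeasure (density lborel (\<lambda>x. ennreal (f (norm x)))) A))"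

text \<open>Only times \<open>t \<ge> 0\<close> are constrained; the values of \<open>X\<close> at negative times are junk.\<close>

locale levy_process = prob_space M for M :: "'w measure" +
  fixes X :: "real \<Rightarrow> 'w \<Rightarrow> 'a::euclidean_space"
  assumes measurable_X: "t \<ge> 0 \<Longrightarrow> X t \<in> measurable M borel"
    and start_zero: "AE w in M. X 0 w = 0"
    and independent_increments:
      "\<And>(n::nat) t. 0 \<le> t 0 \<Longrightarrow> (\<And>i. i < n \<Longrightarrow> t i < t (Suc i)) \<Longrightarrow>
         indep_vars (\<lambda>_. borel) (\<lambda>i w. X (t (Suc i)) w - X (t i) w) {..<n}"
    and stationary_increments:
      "\<And>s t. 0 \<le> s \<Longrightarrow> 0 \<le> t \<Longrightarrow>
         distr M borel (\<lambda>w. X (s + t) w - X s w) = distr M borel (\<lambda>w. X t w - X 0 w)"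
    and stochastically_continuous:
      "\<And>t \<epsilon>. 0 \<le> t \<Longrightarrow> 0 < \<epsilon> \<Longrightarrow>
         ((\<lambda>s. prob {w \<in> space M. \<epsilon> < dist (X s w) (X t w)}) \<longlongrightarrow> 0) (at t within {0..})"
    and cadlag:
      "AE w in M. (\<forall>t\<ge>0. continuous (at_right t) (\<lambda>s. X s w)) \<and>
                  (\<forall>t>0. \<exists>l. ((\<lambda>s. X s w) \<longlongrightarrow> l) (at_left t))"

locale isotropic_levy_process = levy_process M X
  for M :: "'w measure" and X :: "real \<Rightarrow> 'w \<Rightarrow> 'a::euclidean_space" +
  assumes isotropic: "t \<ge> 0 \<Longrightarrow> rotation_invariant (distr M borel (X t))"

locale isotropic_unimodal_levy_process = isotropic_levy_process M X
  for M :: "'w measure" and X :: "real \<Rightarrow> 'w \<Rightarrow> 'a::euclidean_space" +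
  assumes unimodal: "t > 0 \<Longrightarrow> isotropic_unimodal (distr M borel (X t))"

definition levy_khintchine_exponent ::
  "'w measure \<Rightarrow> (real \<Rightarrow> 'w \<Rightarrow> 'a::euclidean_space) \<Rightarrow> ('a \<Rightarrow> real) \<Rightarrow> bool" where
  "levy_khintchine_exponent M X \<psi> \<longleftrightarrow>
     (\<forall>t\<ge>0. \<forall>\<xi>. (CLINT x|distr M borel (X t). iexp (\<xi> \<bullet> x)) = complex_of_real (exp (- t * \<psi> \<xi>))) \<and>
     (\<exists>\<eta> \<nu>. 0 \<le> \<eta> \<and> levy_measure \<nu> \<and> rotation_invariant \<nu> \<and>
        (\<forall>\<xi>. \<psi> \<xi> = (LINT x|\<nu>. 1 - cos (\<xi> \<bullet> x)) + \<eta> * (norm \<xi>)\<^sup>2))"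

text \<open>
  The common value of a radial function on the sphere of radius \<open>r\<close>; only meaningful for
  \<open>r \<ge> 0\<close> and \<open>\<psi>\<close> constant on that sphere.
\<close>

definition radial_profile :: "('a::euclidean_space \<Rightarrow> real) \<Rightarrow> real \<Rightarrow> real" where
  "radial_profile \<psi> r = (THE y. \<forall>\<xi>. norm \<xi> = r \<longrightarrow> \<psi> \<xi> = y)"

text \<open>
  The potential measure as an extended-real-valued set function, to be read on Borel sets only.
\<close>

definition potential_measure ::
  "'w measure \<Rightarrow> (real \<Rightarrow> 'w \<Rightarrow> 'a::euclidean_space) \<Rightarrow> 'a set \<Rightarrow> ennreal" where
  "potential_measure M X A = (\<integral>\<^sup>+t\<in>{0..}. emeasure M {w \<in> space M. X t w \<in> A} \<partial>lborel)"

definition regularly_varying_at_top :: "real \<Rightarrow> (real \<Rightarrow> real) \<Rightarrow> bool" where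
  "regularly_varying_at_top \<alpha> f \<longleftrightarrow>
     (\<exists>x0>0. \<forall>x\<ge>x0. 0 < f x) \<and>
     (\<forall>c>0. ((\<lambda>x. f (c * x) / f x) \<longlongrightarrow> c powr \<alpha>) at_top)"

end

theory Submission
  imports Defs
begin

text \<open>
  Write \<open>F\<close> for the image of the potential measure under \<open>x \<mapsto> (norm x)\<^sup>2\<close>, so that the
  potential of the ball of radius \<open>r\<close> is the mass that \<open>F\<close> gives to \<open>{..r\<^sup>2}\<close>. The behaviour
  of this mass as \<open>r\<close> tends to \<open>0\<close> is read off from the Laplace transform of \<open>F\<close> near
  infinity, by Karamata's Tauberian theorem.

  The Laplace transform is explicit (\<open>laplace_square_potential\<close>). As
  \<open>exp (- s * (norm x)\<^sup>2)\<close> is the characteristic function of \<open>sqrt (2 * s) *\<^sub>R Y\<close> with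
  \<open>Y\<close> standard Gaussian, its mean under the law of \<open>X t\<close> is the Gaussian mean of
  \<open>exp (- t * \<psi> (sqrt (2 * s) *\<^sub>R Y))\<close>. Integration over \<open>t\<close> shows that the Laplace transform
  of \<open>F\<close> at \<open>s\<close> is the Gaussian mean of \<open>1 / \<psi> (sqrt (2 * s) *\<^sub>R Y)\<close>.

  Multiply by \<open>\<psi> (sqrt s)\<close>, where \<open>\<psi>\<close> also denotes the radial profile, and let \<open>s\<close> tend
  to infinity. Regular variation makes the integrand converge to \<open>(sqrt 2 * norm Y) powr (- \<alpha>)\<close>,
  whose mean is \<open>2 powr (- \<alpha>) * Gamma ((d - \<alpha>) / 2) / Gamma (d / 2)\<close> by
  \<open>nn_integral_std_gaussian_norm_powr\<close>. The factor \<open>1 / Gamma (1 + \<alpha> / 2)\<close> in the limit is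
  the one from Karamata's theorem for the index \<open>\<alpha> / 2\<close>.

  Domination is the delicate point, as the argument \<open>sqrt (2 * s) * norm Y\<close> also takes small
  values. It is settled by a bound that isotropy provides (\<open>radial_profile_growth\<close>). The
  square root of a negative definite function is subadditive, and in dimension at least two every
  vector of length at most \<open>2 * u\<close> is a sum of two vectors of length \<open>u\<close>. Hence
  \<open>\<psi> v \<le> 4 * \<psi> u\<close> for \<open>v \<le> 2 * u\<close>, and by iteration
  \<open>\<psi> R \<le> 4 * (1 + (R / u)\<^sup>2) * \<psi> u\<close> for \<open>R \<ge> 0\<close> and \<open>u > 0\<close>. The majorant
  \<open>4 * (1 + norm Y powr (- 2))\<close> has finite mean exactly when \<open>d \<ge> 3\<close>.

  Karamata's theorem (\<open>karamata_tauberian\<close>) is deduced from a continuity theorem for Laplace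
  transforms (\<open>laplace_continuity_theorem\<close>), in which the Weierstrass approximation theorem does
  the work. It covers all \<open>\<alpha>\<close> in \<open>[0, 2]\<close> uniformly; for \<open>\<alpha> = 0\<close> the limit measure is a
  point mass at the origin.
\<close>

section \<open>A continuity theorem for Laplace transforms\<close>

text \<open>
  Such a measure need not be finite, but its tilt by \<open>exp (- z)\<close> is a finite measure.
  Estimates for it are made under that tilt, which is why \<open>exp (- z)\<close> serves as the
  yardstick in all bounds.
\<close>

definition laplace_integrable :: "real measure \<Rightarrow> bool" where
  "laplace_integrable \<mu> \<longleftrightarrow>
     sets \<mu> = sets borel \<and> (AE z in \<mu>. 0 \<le> z) \<and> integrable \<mu> (\<lambda>z. exp (- z))"

lemma laplace_integrable_bounded:
  fixes f :: "real \<Rightarrow> real"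
  assumes \<mu>: "laplace_integrable \<mu>"
    and f [measurable]: "f \<in> borel_measurable borel"
    and le: "\<And>z. 0 \<le> z \<Longrightarrow> \<bar>f z\<bar> \<le> B * exp (- z)"
  shows "integrable \<mu> f" and "\<bar>LINT z|\<mu>. f z\<bar> \<le> B * (LINT z|\<mu>. exp (- z))"
proof -
  have [measurable_cong]: "sets \<mu> = sets borel" and pos: "AE z in \<mu>. 0 \<le> z"
    and int: "integrable \<mu> (\<lambda>z. B * exp (- z))"
    using \<mu> by (auto simp: laplace_integrable_def)
  have AE: "AE z in \<mu>. norm (f z) \<le> B * exp (- z)"
    using pos by eventually_elim (use le in auto)
  show *: "integrable \<mu> f"
    by (rule Bochner_Integration.integrable_bound[OF int])
       (use AE in \<open>auto elim!: eventually_mono\<close>)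
  have "\<bar>LINT z|\<mu>. f z\<bar> \<le> (LINT z|\<mu>. B * exp (- z))"
    using AE * int
    by (intro order_trans[OF integral_abs_bound] integral_mono_AE) auto
  then show "\<bar>LINT z|\<mu>. f z\<bar> \<le> B * (LINT z|\<mu>. exp (- z))"
    by simp
qed

text \<open>
  The substitution \<open>y = exp (- z)\<close> turns \<open>f z / exp (- z)\<close> into a function of \<open>y\<close> on
  \<open>[0, 1]\<close>. It is continuous also at \<open>y = 0\<close> because \<open>f\<close> vanishes for large \<open>z\<close>, so
  the Weierstrass theorem applies. Dividing by \<open>exp (- z)\<close> first is what makes the error
  proportional to \<open>exp (- z)\<close>, hence integrable against an infinite measure.
\<close>

lemma exponential_polynomial_approximation:
  fixes f :: "real \<Rightarrow> real"
  assumes cont: "continuous_on {0..} f" and K: "0 \<le> K" "\<And>z. K \<le> z \<Longrightarrow> f z = 0" and e: "0 < e"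
  obtains n a where "\<And>z. 0 \<le> z \<Longrightarrow> \<bar>f z - (\<Sum>i\<le>n. a i * exp (- (real (Suc i) * z)))\<bar> \<le> e * exp (- z)"
proof -
  define g where "g y = (if y \<le> exp (- K) then 0 else f (- ln y) / y)" for y
  have "continuous_on ({0..exp (- K)} \<union> {exp (- K)..1}) g"
    unfolding g_def
  proof (rule continuous_on_If)
    show "continuous_on {exp (- K)..1} (\<lambda>y. f (- ln y) / y)"
      using exp_gt_zero[of "- K"]
      by (intro continuous_intros continuous_on_compose2[OF cont])
         (auto simp del: exp_gt_zero)
  qed (use K in \<open>auto dest: antisym\<close>)
  moreover have "{0..exp (- K)} \<union> {exp (- K)..1} = {0..1}"
    using K order_trans[OF exp_ge_zero[of "- K"]] by (force intro: order_trans[of _ "exp (- K)"])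
  ultimately have "continuous_on {0..1} g"
    by simp
  then obtain p where p: "real_polynomial_function p" "\<And>y. y \<in> {0..1} \<Longrightarrow> \<bar>g y - p y\<bar> < e"
    using Stone_Weierstrass_real_polynomial_function[of "{0..1}" g e] e by auto
  from p(1) obtain a n where an: "p = (\<lambda>x. \<Sum>i\<le>n. a i * x ^ i)"
    by (auto simp: real_polynomial_function_iff_sum)
  have "\<bar>f z - (\<Sum>i\<le>n. a i * exp (- (real (Suc i) * z)))\<bar> \<le> e * exp (- z)" if z: "0 \<le> z" for z
  proof -
    have "f z = exp (- z) * g (exp (- z))"
      using K(2)[of z] by (auto simp: g_def)
    moreover have "(\<Sum>i\<le>n. a i * exp (- (real (Suc i) * z))) = exp (- z) * p (exp (- z))"
      by (auto simp: an sum_distrib_left exp_of_nat_mult[symmetric] exp_add[symmetric] algebra_simps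
          intro!: sum.cong)
    ultimately have "\<bar>f z - (\<Sum>i\<le>n. a i * exp (- (real (Suc i) * z)))\<bar>
        = exp (- z) * \<bar>g (exp (- z)) - p (exp (- z))\<bar>"
      by (simp add: right_diff_distrib[symmetric] abs_mult)
    also have "\<dots> \<le> exp (- z) * e"
      using p(2)[of "exp (- z)"] z by (intro mult_left_mono) auto
    finally show ?thesis by (simp add: mult.commute)
  qed
  then show thesis by (rule that)
qed

text \<open>
  Laplace transforms at the positive integers are integrals of the powers of \<open>exp (- z)\<close>, so
  their convergence gives convergence for exponential polynomials. The error of the preceding
  approximation is controlled uniformly in \<open>i\<close> because the masses of the tilted measures
  converge.
\<close>

lemma laplace_convergence_test_function:
  fixes m :: "'i \<Rightarrow> real measure" and f :: "real \<Rightarrow> real"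
  assumes m: "\<forall>\<^sub>F i in Fl. laplace_integrable (m i)" and \<mu>: "laplace_integrable \<mu>"
    and conv: "\<And>k. ((\<lambda>i. LINT z|m i. exp (- (real (Suc k) * z))) \<longlongrightarrow>
                      (LINT z|\<mu>. exp (- (real (Suc k) * z)))) Fl"
    and f [measurable]: "f \<in> borel_measurable borel" and cont: "continuous_on {0..} f"
    and K: "0 \<le> K" "\<And>z. K \<le> z \<Longrightarrow> f z = 0"
  shows "((\<lambda>i. LINT z|m i. f z) \<longlongrightarrow> (LINT z|\<mu>. f z)) Fl"
proof (rule tendstoI)
  fix \<epsilon> :: real assume \<epsilon>: "0 < \<epsilon>"
  define L where "L \<nu> = (LINT z|\<nu>. exp (- z))" for \<nu> :: "real measure"
  have L\<mu>: "0 \<le> L \<mu>" unfolding L_def by simp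
  define e where "e = (\<epsilon> / 2) / (2 * L \<mu> + 1)"
  have e: "0 < e" "e * (L \<mu> + 1) + e * L \<mu> = \<epsilon> / 2"
  proof -
    show "0 < e" using \<epsilon> L\<mu> by (simp add: e_def)
    have "e * (2 * L \<mu> + 1) = \<epsilon> / 2"
      unfolding e_def using L\<mu> by (intro nonzero_eq_divide_eq[THEN iffD1]) auto
    then show "e * (L \<mu> + 1) + e * L \<mu> = \<epsilon> / 2" by (simp add: algebra_simps)
  qed
  obtain n a where app: "\<And>z. 0 \<le> z \<Longrightarrow>
      \<bar>f z - (\<Sum>i\<le>n. a i * exp (- (real (Suc i) * z)))\<bar> \<le> e * exp (- z)"
    using exponential_polynomial_approximation[OF cont K e(1)] by blast
  define P where "P z = (\<Sum>i\<le>n. a i * exp (- (real (Suc i) * z)))" for z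
  have P [measurable]: "P \<in> borel_measurable borel"
    unfolding P_def by measurable
  have int_exp: "integrable \<nu> (\<lambda>z. exp (- (real (Suc i) * z)))" if "laplace_integrable \<nu>" for \<nu> i
    by (rule laplace_integrable_bounded(1)[OF that, where B = 1]) (auto simp: algebra_simps)
  have IP: "integrable \<nu> P" "(LINT z|\<nu>. P z) = (\<Sum>i\<le>n. a i * (LINT z|\<nu>. exp (- (real (Suc i) * z))))"
    if "laplace_integrable \<nu>" for \<nu>
    unfolding P_def using int_exp[OF that] by (auto simp del: of_nat_Suc)
  have err: "\<bar>(LINT z|\<nu>. f z) - (LINT z|\<nu>. P z)\<bar> \<le> e * L \<nu>" if \<nu>: "laplace_integrable \<nu>" for \<nu>
  proof -
    have "\<bar>f z - P z\<bar> \<le> e * exp (- z)" if "0 \<le> z" for z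
      using app[OF that] by (simp add: P_def)
    then have d: "integrable \<nu> (\<lambda>z. f z - P z)" "\<bar>LINT z|\<nu>. f z - P z\<bar> \<le> e * L \<nu>"
      unfolding L_def
      using laplace_integrable_bounded[OF \<nu>, of "\<lambda>z. f z - P z" e] by auto
    have "integrable \<nu> (\<lambda>z. (f z - P z) + P z)"
      by (intro Bochner_Integration.integrable_add d IP[OF \<nu>])
    then have "integrable \<nu> f" by simp
    with d(2) IP(1)[OF \<nu>] show ?thesis by simp
  qed
  have "((\<lambda>i. \<Sum>j\<le>n. a j * (LINT z|m i. exp (- (real (Suc j) * z)))) \<longlongrightarrow>
         (\<Sum>j\<le>n. a j * (LINT z|\<mu>. exp (- (real (Suc j) * z))))) Fl"
    by (intro tendsto_intros conv)
  then have "\<forall>\<^sub>F i in Fl. dist (\<Sum>j\<le>n. a j * (LINT z|m i. exp (- (real (Suc j) * z)))) (LINT z|\<mu>. P z) < \<epsilon> / 2"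
    using \<epsilon> unfolding IP(2)[OF \<mu>] by (intro tendstoD) auto
  moreover have "\<forall>\<^sub>F i in Fl. dist (L (m i)) (L \<mu>) < 1"
    using conv[of 0] unfolding L_def by (intro tendstoD) auto
  ultimately show "\<forall>\<^sub>F i in Fl. dist (LINT z|m i. f z) (LINT z|\<mu>. f z) < \<epsilon>"
    using m
  proof eventually_elim
    case (elim i)
    have "e * L (m i) \<le> e * (L \<mu> + 1)"
      using elim(2) e(1) by (intro mult_left_mono) (auto simp: dist_real_def)
    moreover have "\<bar>(LINT z|m i. P z) - (LINT z|\<mu>. P z)\<bar> < \<epsilon> / 2"
      using elim(1) unfolding IP(2)[OF elim(3)] by (simp add: dist_real_def)
    ultimately show ?case
      using err[OF elim(3)] err[OF \<mu>] e(2) unfolding dist_real_def by linarith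
  qed
qed

lemma cts_step_measurable [measurable]: "cts_step a b \<in> borel_measurable borel"
  unfolding cts_step_def by measurable

lemma measure_between_cts_steps:
  assumes \<nu>: "laplace_integrable \<nu>" and less: "a < x" "x < b"
  shows "(LINT z|\<nu>. cts_step a x z) \<le> measure \<nu> {..x}"
    and "measure \<nu> {..x} \<le> (LINT z|\<nu>. cts_step x b z)"
proof -
  have sets [measurable_cong]: "sets \<nu> = sets borel"
    using \<nu> by (simp add: laplace_integrable_def)
  have int: "integrable \<nu> (cts_step c d)" if "c < d" for c d
  proof (rule laplace_integrable_bounded(1)[OF \<nu>, where B = "exp d"])
    show "\<bar>cts_step c d z\<bar> \<le> exp d * exp (- z)" if "0 \<le> z" for z
    proof (cases "z < d")
      case True
      then have "\<bar>cts_step c d z\<bar> \<le> 1" using \<open>c < d\<close> by (auto simp: cts_step_def)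
      also have "1 \<le> exp d * exp (- z)" using True by (simp add: exp_add[symmetric])
      finally show ?thesis .
    qed (use \<open>c < d\<close> in \<open>auto simp: cts_step_def\<close>)
  qed simp
  have ind: "integrable \<nu> (indicator {..x} :: real \<Rightarrow> real)"
  proof (rule laplace_integrable_bounded(1)[OF \<nu>, where B = "exp x"])
    show "\<bar>indicator {..x} z\<bar> \<le> exp x * exp (- z)" for z :: real
      by (auto simp: indicator_def exp_add[symmetric])
  qed simp
  have sp: "space \<nu> = UNIV" using sets_eq_imp_space_eq[OF sets] by simp
  have eq: "measure \<nu> {..x} = (LINT z|\<nu>. indicator {..x} z)"
    by (simp add: sp)
  show "(LINT z|\<nu>. cts_step a x z) \<le> measure \<nu> {..x}"
    unfolding eq by (rule integral_mono[OF int ind])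
      (use less in \<open>auto simp: cts_step_def indicator_def\<close>)
  show "measure \<nu> {..x} \<le> (LINT z|\<nu>. cts_step x b z)"
    unfolding eq by (rule integral_mono[OF ind int])
      (use less in \<open>auto simp: cts_step_def indicator_def\<close>)
qed

text \<open>
  The indicator of \<open>{..x}\<close> is squeezed between continuous steps that end or begin at
  \<open>x\<close>. Under the limit measure both squeezing integrals tend to the mass of \<open>{..x}\<close>; for
  the lower one this needs that \<open>x\<close> is not an atom.
\<close>

theorem laplace_continuity_theorem:
  fixes m :: "'i \<Rightarrow> real measure"
  assumes m: "\<forall>\<^sub>F i in Fl. laplace_integrable (m i)" and \<mu>: "laplace_integrable \<mu>"
    and conv: "\<And>k. ((\<lambda>i. LINT z|m i. exp (- (real (Suc k) * z))) \<longlongrightarrow>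
                      (LINT z|\<mu>. exp (- (real (Suc k) * z)))) Fl"
    and x: "0 < x" and no_atom: "measure \<mu> {x} = 0"
  shows "((\<lambda>i. measure (m i) {..x}) \<longlongrightarrow> measure \<mu> {..x}) Fl"
proof -
  have [measurable_cong]: "sets \<mu> = sets borel" using \<mu> by (simp add: laplace_integrable_def)
  have sp: "space \<mu> = UNIV" using sets_eq_imp_space_eq[of \<mu> borel] \<mu>
    by (simp add: laplace_integrable_def)
  have step: "((\<lambda>i. LINT z|m i. cts_step c d z) \<longlongrightarrow> (LINT z|\<mu>. cts_step c d z)) Fl"
    if "0 < c" "c < d" for c d
    using that cts_step_uniformly_continuous[of c d]
    by (intro laplace_convergence_test_function[OF m \<mu> conv, where K = d])
       (auto intro: continuous_on_subset uniformly_continuous_imp_continuous simp: cts_step_def[abs_def])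
  have dom: "integrable \<mu> (\<lambda>z. exp (x + 1) * exp (- z))"
    using \<mu> by (simp add: laplace_integrable_def)
  have bound: "norm (cts_step c d z) \<le> exp (x + 1) * exp (- z)" if "c < d" "d \<le> x + 1" for c d z
  proof (cases "z < d")
    case True
    then have "\<bar>cts_step c d z\<bar> \<le> 1" using \<open>c < d\<close> by (auto simp: cts_step_def)
    also have "1 \<le> exp (x + 1) * exp (- z)" using True that by (simp add: exp_add[symmetric])
    finally show ?thesis by simp
  qed (use \<open>c < d\<close> in \<open>auto simp: cts_step_def\<close>)
  have fin: "emeasure \<mu> {x} \<noteq> \<infinity>"
  proof -
    have "integrable \<mu> (indicator {x} :: real \<Rightarrow> real)"
      by (rule laplace_integrable_bounded(1)[OF \<mu>, where B = "exp x"])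
         (auto simp: indicator_def exp_add[symmetric])
    then show ?thesis by (simp add: sp less_top[symmetric] integrable_indicator_iff)
  qed
  have not_x: "AE z in \<mu>. z \<noteq> x"
    using no_atom fin by (intro AE_I[where N = "{x}"]) (auto simp: measure_def enn2real_eq_0_iff sp)
  \<comment> \<open>The widths stay below \<open>x\<close>, so that the lower steps are test functions that begin to fall at a positive point.\<close>
  define \<delta> where "\<delta> n = min (x / 2) 1 / real (Suc n)" for n
  have \<delta>: "0 < \<delta> n" "\<delta> n < x" "\<delta> n \<le> 1" for n
  proof -
    have "\<delta> n \<le> min (x / 2) 1" using x unfolding \<delta>_def by (auto simp: divide_le_eq min_def)
    then show "\<delta> n < x" "\<delta> n \<le> 1" using x by auto
  qed (use x in \<open>auto simp: \<delta>_def\<close>)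
  have \<delta>0: "\<delta> \<longlonglongrightarrow> 0"
    unfolding \<delta>_def by (rule LIMSEQ_Suc[OF lim_const_over_n])
  have eq: "measure \<mu> {..x} = (LINT z|\<mu>. indicator {..x} z)"
    by (simp add: sp)
  have lower: "(\<lambda>n. LINT z|\<mu>. cts_step (x - \<delta> n) x z) \<longlonglongrightarrow> measure \<mu> {..x}"
    unfolding eq
  proof (rule integral_dominated_convergence[OF _ _ dom])
    show "AE z in \<mu>. (\<lambda>n. cts_step (x - \<delta> n) x z) \<longlonglongrightarrow> indicator {..x} z"
      using not_x
    proof eventually_elim
      case (elim z)
      show ?case
      proof (cases "z < x")
        case True
        then have "\<forall>\<^sub>F n in sequentially. \<delta> n < x - z"
          using \<delta>0 by (intro order_tendstoD) auto
        then have "\<forall>\<^sub>F n in sequentially. cts_step (x - \<delta> n) x z = indicator {..x} z"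
          by eventually_elim (use True in \<open>auto simp: cts_step_def\<close>)
        then show ?thesis by (rule tendsto_eventually)
      next
        case False
        then have "cts_step (x - \<delta> n) x z = indicator {..x} z" for n
          using elim \<delta>[of n] by (auto simp: cts_step_def)
        then show ?thesis by simp
      qed
    qed
    show "AE z in \<mu>. norm (cts_step (x - \<delta> n) x z) \<le> exp (x + 1) * exp (- z)" for n
      using bound[of "x - \<delta> n" x] \<delta>[of n] by (auto intro!: AE_I2)
  qed simp_all
  have upper: "(\<lambda>n. LINT z|\<mu>. cts_step x (x + \<delta> n) z) \<longlonglongrightarrow> measure \<mu> {..x}"
    unfolding eq
  proof (rule integral_dominated_convergence[OF _ _ dom])
    show "AE z in \<mu>. (\<lambda>n. cts_step x (x + \<delta> n) z) \<longlonglongrightarrow> indicator {..x} z"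
    proof (rule AE_I2)
      fix z
      show "(\<lambda>n. cts_step x (x + \<delta> n) z) \<longlonglongrightarrow> indicator {..x} z"
      proof (cases "z \<le> x")
        case False
        then have "\<forall>\<^sub>F n in sequentially. \<delta> n < z - x"
          using \<delta>0 by (intro order_tendstoD) auto
        then have "\<forall>\<^sub>F n in sequentially. cts_step x (x + \<delta> n) z = indicator {..x} z"
          by eventually_elim (use False in \<open>auto simp: cts_step_def\<close>)
        then show ?thesis by (rule tendsto_eventually)
      qed (simp add: cts_step_def)
    qed
    show "AE z in \<mu>. norm (cts_step x (x + \<delta> n) z) \<le> exp (x + 1) * exp (- z)" for n
      using bound[of x "x + \<delta> n"] \<delta>[of n] by (auto intro!: AE_I2)
  qed simp_all
  show ?thesis
  proof (rule order_tendstoI)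
    fix y assume "y < measure \<mu> {..x}"
    then obtain n where n: "y < (LINT z|\<mu>. cts_step (x - \<delta> n) x z)"
      using order_tendstoD(1)[OF lower] by (auto simp: eventually_sequentially)
    have "\<forall>\<^sub>F i in Fl. y < (LINT z|m i. cts_step (x - \<delta> n) x z)"
      by (rule order_tendstoD(1)[OF step n]) (use \<delta>[of n] in auto)
    with m show "\<forall>\<^sub>F i in Fl. y < measure (m i) {..x}"
    proof eventually_elim
      case (elim i)
      with measure_between_cts_steps(1)[of "m i" "x - \<delta> n" x "x + 1"] \<delta>[of n] show ?case by auto
    qed
  next
    fix y assume "measure \<mu> {..x} < y"
    then obtain n where n: "(LINT z|\<mu>. cts_step x (x + \<delta> n) z) < y"
      using order_tendstoD(2)[OF upper] by (auto simp: eventually_sequentially)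
    have "\<forall>\<^sub>F i in Fl. (LINT z|m i. cts_step x (x + \<delta> n) z) < y"
      by (rule order_tendstoD(2)[OF step n]) (use \<delta>[of n] x in auto)
    with m show "\<forall>\<^sub>F i in Fl. measure (m i) {..x} < y"
    proof eventually_elim
      case (elim i)
      with measure_between_cts_steps(2)[of "m i" "x/2" x "x + \<delta> n"] \<delta>[of n] x show ?case by auto
    qed
  qed
qed

section \<open>Karamata's Tauberian theorem\<close>

text \<open>
  The gamma integral is stated with values in \<open>ennreal\<close>: it is used inside Tonelli
  interchanges, where no integrability has to be checked in advance.
\<close>

lemma nn_integral_gamma:
  fixes a s :: real
  assumes a: "0 < a" and s: "0 < s"
  shows "(\<integral>\<^sup>+u. ennreal (indicator {0..} u * u powr (a - 1) * exp (- (s * u))) \<partial>lborel)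
         = ennreal (Gamma a * s powr (- a))"
proof -
  let ?J = "\<integral>\<^sup>+u. ennreal (indicator {0..} u * u powr (a - 1) * exp (- (s * u))) \<partial>lborel"
  have "ennreal (Gamma a) = ennreal s * (\<integral>\<^sup>+u. ennreal (indicator {0..} (s * u) * (s * u) powr (a - 1) / exp (s * u)) \<partial>lborel)"
    using nn_integral_real_affine[of "\<lambda>t. ennreal (indicator {0..} t * t powr (a - 1) / exp t)" s 0] s
    by (simp add: Gamma_conv_nn_integral_real[OF a])
  also have "\<dots> = ennreal s * (\<integral>\<^sup>+u. ennreal (s powr (a - 1)) *
      ennreal (indicator {0..} u * u powr (a - 1) * exp (- (s * u))) \<partial>lborel)"
    using s by (intro arg_cong2[where f = "(*)"] refl nn_integral_cong, subst ennreal_mult[symmetric])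
      (auto simp: indicator_def powr_mult exp_minus field_simps zero_le_mult_iff)
  also have "\<dots> = ennreal (s powr a) * ?J"
    using s by (subst nn_integral_cmult, measurable)
      (simp add: mult.assoc[symmetric] ennreal_mult[symmetric] powr_mult_base)
  finally have "ennreal (s powr - a) * ennreal (Gamma a) = ennreal (s powr - a) * ennreal (s powr a) * ?J"
    by (simp add: mult.assoc)
  also have "ennreal (s powr - a) * ennreal (s powr a) = 1"
    using s by (simp add: ennreal_mult[symmetric] powr_add[symmetric])
  finally show ?thesis
    using a s by (simp add: ennreal_mult[symmetric] mult.commute)
qed

text \<open>
  The measure with Laplace transform \<open>s powr (- \<rho>)\<close>. For \<open>\<rho> = 0\<close> it degenerates to the
  unit mass at the origin, for which the density formula breaks down.
\<close>

definition power_law :: "real \<Rightarrow> real measure" where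
  "power_law \<rho> = (if \<rho> = 0 then return borel 0
     else density lborel (\<lambda>z. ennreal (indicator {0..} z * z powr (\<rho> - 1) / Gamma \<rho>)))"

lemma sets_power_law [simp, measurable_cong]: "sets (power_law \<rho>) = sets borel"
  by (simp add: power_law_def)

lemma AE_power_law_nonneg: "AE z in power_law \<rho>. 0 \<le> z"
proof (cases "\<rho> = 0")
  case False
  show ?thesis
    unfolding power_law_def if_not_P[OF False]
    by (subst AE_density) (auto simp: indicator_def)
next
  case True
  then show ?thesis
    unfolding power_law_def if_P[OF True] by (subst AE_return) auto
qed

lemma emeasure_power_law_singleton: "0 < x \<Longrightarrow> emeasure (power_law \<rho>) {x} = 0"
  by (auto simp: power_law_def emeasure_density nn_integral_cmult_indicator
      intro!: nn_integral_null_set)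

lemma nn_integral_power_law_exp:
  assumes \<rho>: "0 \<le> \<rho>" and s: "0 < s"
  shows "(\<integral>\<^sup>+z. ennreal (exp (- (s * z))) \<partial>power_law \<rho>) = ennreal (s powr (- \<rho>))"
proof (cases "\<rho> = 0")
  case True
  then show ?thesis using s by (simp add: power_law_def nn_integral_return)
next
  case False
  with \<rho> have \<rho>: "0 < \<rho>" by simp
  have G: "0 < Gamma \<rho>" using \<rho> by (rule Gamma_real_pos)
  have "(\<integral>\<^sup>+z. ennreal (exp (- (s * z))) \<partial>power_law \<rho>)
      = (\<integral>\<^sup>+z. ennreal (1 / Gamma \<rho>) * ennreal (indicator {0..} z * z powr (\<rho> - 1) * exp (- (s * z))) \<partial>lborel)"
    using False G unfolding power_law_def
    by (simp add: nn_integral_density ennreal_mult[symmetric])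
  also have "\<dots> = ennreal (1 / Gamma \<rho>) * ennreal (Gamma \<rho> * s powr (- \<rho>))"
    by (simp add: nn_integral_cmult nn_integral_gamma[OF \<rho> s])
  finally show ?thesis using G by (simp add: ennreal_mult[symmetric])
qed

lemma emeasure_power_law_atMost_1:
  assumes \<rho>: "0 \<le> \<rho>"
  shows "emeasure (power_law \<rho>) {..1} = ennreal (1 / Gamma (1 + \<rho>))"
proof (cases "\<rho> = 0")
  case False
  with \<rho> have \<rho>: "0 < \<rho>" by simp
  have G: "0 < Gamma \<rho>" using \<rho> by (rule Gamma_real_pos)
  have "((\<lambda>z. z powr (\<rho> - 1)) has_integral (1 powr \<rho> / \<rho>)) {0..1}"
    using has_integral_powr_from_0[of "\<rho> - 1" 1] \<rho> by simp
  then have int: "(\<integral>\<^sup>+z. ennreal (z powr (\<rho> - 1)) * indicator {0..1} z \<partial>lborel) = ennreal (1 / \<rho>)"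
    by (subst nn_integral_has_integral_lebesgue'[where I = "1 / \<rho>"]) auto
  have "emeasure (power_law \<rho>) {..1}
      = (\<integral>\<^sup>+z. ennreal (1 / Gamma \<rho>) * (ennreal (z powr (\<rho> - 1)) * indicator {0..1} z) \<partial>lborel)"
    using False G by (auto simp: power_law_def emeasure_density ennreal_mult[symmetric] indicator_def
        intro!: nn_integral_cong)
  also have "\<dots> = ennreal (1 / Gamma \<rho>) * ennreal (1 / \<rho>)"
    by (simp add: nn_integral_cmult int)
  also have "\<dots> = ennreal (1 / Gamma (1 + \<rho>))"
    using G \<rho> Gamma_plus1[of \<rho>] by (simp add: ennreal_mult[symmetric] add.commute nonpos_Ints_def)
  finally show ?thesis .
qed (simp add: power_law_def)

text \<open>
  Karamata's Tauberian theorem. Rescaling \<open>F\<close> by \<open>s\<close> and multiplying by \<open>a s\<close>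
  yields measures whose Laplace transforms converge to that of \<open>c\<close> times the power law. By
  the continuity theorem their masses on \<open>{..1}\<close> converge too, and these masses are
  \<open>a s * emeasure F {..1 / s}\<close>.
\<close>

theorem karamata_tauberian:
  fixes F :: "real measure" and a :: "real \<Rightarrow> real"
  assumes sets: "sets F = sets borel" and pos: "AE z in F. 0 \<le> z"
    and \<rho>: "0 \<le> \<rho>" and c: "0 \<le> c"
    and conv: "\<And>k. ((\<lambda>s. ennreal (a s) * (\<integral>\<^sup>+z. ennreal (exp (- (real (Suc k) * (s * z)))) \<partial>F))
                 \<longlongrightarrow> ennreal (c * real (Suc k) powr (- \<rho>))) at_top"
  shows "((\<lambda>s. ennreal (a s) * emeasure F {..1 / s}) \<longlongrightarrow> ennreal (c / Gamma (1 + \<rho>))) at_top"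
proof -
  note [measurable_cong] = sets
  have sp: "space F = UNIV" using sets_eq_imp_space_eq[OF sets] by simp
  define m where "m s = density (distr F borel (\<lambda>z. s * z)) (\<lambda>_. ennreal (a s))" for s
  define \<mu> where "\<mu> = density (power_law \<rho>) (\<lambda>_. ennreal c)"
  have m_nn: "(\<integral>\<^sup>+z. f z \<partial>m s) = ennreal (a s) * (\<integral>\<^sup>+z. f (s * z) \<partial>F)"
    if [measurable]: "f \<in> borel_measurable borel" for f s
    by (simp add: m_def nn_integral_density nn_integral_distr nn_integral_cmult)
  have \<mu>_nn: "(\<integral>\<^sup>+z. f z \<partial>\<mu>) = ennreal c * (\<integral>\<^sup>+z. f z \<partial>power_law \<rho>)"
    if [measurable]: "f \<in> borel_measurable borel" for f
    by (simp add: \<mu>_def nn_integral_density nn_integral_cmult)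
  have [simp, measurable_cong]: "sets (m s) = sets borel" "sets \<mu> = sets borel" for s
    by (auto simp: m_def \<mu>_def)
  have \<mu>_exp: "(\<integral>\<^sup>+z. ennreal (exp (- (real (Suc k) * z))) \<partial>\<mu>) = ennreal (c * real (Suc k) powr (- \<rho>))" for k
    using c by (simp add: \<mu>_nn nn_integral_power_law_exp[OF \<rho>] ennreal_mult del: of_nat_Suc)
  have \<mu>: "laplace_integrable \<mu>"
    unfolding laplace_integrable_def
  proof (intro conjI)
    show "AE z in \<mu>. 0 \<le> z"
      unfolding \<mu>_def using AE_power_law_nonneg[of \<rho>] by (subst AE_density) (auto elim: eventually_mono)
    show "integrable \<mu> (\<lambda>z. exp (- z))"
      using \<mu>_exp[of 0] by (intro integrableI_nonneg) auto
  qed simp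
  have conv_nn: "((\<lambda>s. \<integral>\<^sup>+z. ennreal (exp (- (real (Suc k) * z))) \<partial>m s)
      \<longlongrightarrow> ennreal (c * real (Suc k) powr (- \<rho>))) at_top" for k
    using conv[of k] by (simp add: m_nn)
  have m: "\<forall>\<^sub>F s in at_top. laplace_integrable (m s)"
  proof -
    have "\<forall>\<^sub>F s in at_top. (\<integral>\<^sup>+z. ennreal (exp (- (real (Suc 0) * z))) \<partial>m s) < \<infinity>"
      by (rule order_tendstoD(2)[OF conv_nn]) auto
    with eventually_ge_at_top[of 0] show ?thesis
    proof eventually_elim
      case (elim s)
      have "AE z in distr F borel (\<lambda>z. s * z). 0 \<le> z"
        using pos elim(1) by (subst AE_distr_iff) (auto elim!: eventually_mono)
      then have "AE z in m s. 0 \<le> z"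
        unfolding m_def by (subst AE_density) (auto elim: eventually_mono)
      with elim(2) show ?case
        by (auto simp: laplace_integrable_def intro!: integrableI_nonneg)
    qed
  qed
  have conv_int: "((\<lambda>s. LINT z|m s. exp (- (real (Suc k) * z))) \<longlongrightarrow>
      (LINT z|\<mu>. exp (- (real (Suc k) * z)))) at_top" for k
    using tendsto_enn2real[OF conv_nn[of k]] c
    by (simp add: integral_eq_nn_integral \<mu>_exp del: of_nat_Suc)
  have "measure \<mu> {1} = 0"
    by (simp add: measure_def \<mu>_def emeasure_density_const emeasure_power_law_singleton)
  from laplace_continuity_theorem[OF m \<mu> conv_int _ this]
  have lim: "((\<lambda>s. measure (m s) {..1}) \<longlongrightarrow> measure \<mu> {..1}) at_top" by simp
  have "emeasure \<mu> {..1} = ennreal (c / Gamma (1 + \<rho>))"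
    using c \<rho> Gamma_real_pos[of "1 + \<rho>"]
    by (simp add: \<mu>_def emeasure_density_const emeasure_power_law_atMost_1 ennreal_mult[symmetric])
  then have "measure \<mu> {..1} = c / Gamma (1 + \<rho>)"
    using c \<rho> Gamma_real_pos[of "1 + \<rho>"] by (simp add: measure_def)
  with tendsto_ennrealI[OF lim]
  have "((\<lambda>s. ennreal (measure (m s) {..1})) \<longlongrightarrow> ennreal (c / Gamma (1 + \<rho>))) at_top"
    by simp
  moreover have "\<forall>\<^sub>F s in at_top. ennreal (measure (m s) {..1}) = ennreal (a s) * emeasure F {..1 / s}"
    using m eventually_gt_at_top[of 0]
  proof eventually_elim
    case (elim s)
    have "integrable (m s) (indicator {..1} :: real \<Rightarrow> real)"
      by (rule laplace_integrable_bounded(1)[OF elim(1), where B = "exp 1"])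
         (auto simp: indicator_def exp_add[symmetric])
    then have "emeasure (m s) {..1} \<noteq> \<infinity>"
      by (simp add: integrable_indicator_iff m_def less_top[symmetric])
    then have "ennreal (measure (m s) {..1}) = emeasure (m s) {..1}"
      by (simp add: emeasure_eq_ennreal_measure)
    also have "\<dots> = ennreal (a s) * emeasure F ((\<lambda>z. s * z) -` {..1})"
      by (simp add: m_def emeasure_density_const emeasure_distr sp)
    also have "(\<lambda>z. s * z) -` {..1} = {..1 / s}"
      using elim(2) by (auto simp: field_simps)
    finally show ?case .
  qed
  ultimately show ?thesis
    by (rule Lim_transform_eventually)
qed

section \<open>Gaussian averages\<close>

text \<open>
  As the image of a product measure, this law turns integrals of products of functions of single
  coordinates into products of one-dimensional integrals, for any Euclidean space.
\<close>

definition std_gaussian :: "'a::euclidean_space measure" where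
  "std_gaussian = distr (\<Pi>\<^sub>M b\<in>Basis. std_normal_distribution) borel (\<lambda>y. \<Sum>b\<in>Basis. y b *\<^sub>R b)"

lemma sets_std_gaussian [simp, measurable_cong]: "sets std_gaussian = sets borel"
  by (simp add: std_gaussian_def)

lemma space_std_gaussian [simp]: "space std_gaussian = UNIV"
  by (simp add: std_gaussian_def)

interpretation std_normal: prob_space std_normal_distribution
  by (rule prob_space_normal_density) simp

interpretation std_normal_prod: product_prob_space "\<lambda>_. std_normal_distribution" I for I :: "'a set"
  by standard

interpretation std_gaussian: prob_space "std_gaussian :: 'a::euclidean_space measure"
  unfolding std_gaussian_def
  by (intro prob_space.prob_space_distr prob_space_PiM prob_space_normal_density) auto

lemma nn_integral_std_gaussian_prod:
  fixes g :: "'a::euclidean_space \<Rightarrow> real \<Rightarrow> ennreal"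
  assumes [measurable]: "\<And>b. g b \<in> borel_measurable borel"
  shows "(\<integral>\<^sup>+x. (\<Prod>b\<in>Basis. g b (x \<bullet> b)) \<partial>std_gaussian)
         = (\<Prod>b\<in>Basis. \<integral>\<^sup>+y. g b y \<partial>std_normal_distribution)"
proof -
  have "(\<integral>\<^sup>+x. (\<Prod>b\<in>Basis. g b (x \<bullet> b)) \<partial>std_gaussian)
      = (\<integral>\<^sup>+y. (\<Prod>b\<in>Basis. g b ((\<Sum>b\<in>Basis. y b *\<^sub>R b) \<bullet> b)) \<partial>(\<Pi>\<^sub>M b\<in>(Basis :: 'a set). std_normal_distribution))"
    unfolding std_gaussian_def by (subst nn_integral_distr) auto
  also have "\<dots> = (\<integral>\<^sup>+y. (\<Prod>b\<in>Basis. g b (y b)) \<partial>(\<Pi>\<^sub>M b\<in>(Basis :: 'a set). std_normal_distribution))"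
    by (auto intro!: nn_integral_cong prod.cong)
  also have "\<dots> = (\<Prod>b\<in>Basis. \<integral>\<^sup>+y. g b y \<partial>std_normal_distribution)"
    by (intro std_normal_prod.product_nn_integral_prod) auto
  finally show ?thesis .
qed

lemma integral_std_gaussian_prod:
  fixes g :: "'a::euclidean_space \<Rightarrow> real \<Rightarrow> complex"
  assumes "\<And>b. integrable std_normal_distribution (g b)"
  shows "(LINT x|std_gaussian. (\<Prod>b\<in>Basis. g b (x \<bullet> b)))
         = (\<Prod>b\<in>Basis. LINT y|std_normal_distribution. g b y)"
proof -
  have [measurable]: "g b \<in> borel_measurable borel" for b
    using borel_measurable_integrable[OF assms[of b]] by simp
  have "(LINT x|std_gaussian. (\<Prod>b\<in>Basis. g b (x \<bullet> b)))
      = (LINT y|(\<Pi>\<^sub>M b\<in>(Basis :: 'a set). std_normal_distribution). (\<Prod>b\<in>Basis. g b ((\<Sum>b\<in>Basis. y b *\<^sub>R b) \<bullet> b)))"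
    unfolding std_gaussian_def by (subst integral_distr) auto
  also have "\<dots> = (LINT y|(\<Pi>\<^sub>M b\<in>(Basis :: 'a set). std_normal_distribution). (\<Prod>b\<in>Basis. g b (y b)))"
    by (auto intro!: Bochner_Integration.integral_cong prod.cong)
  also have "\<dots> = (\<Prod>b\<in>Basis. LINT y|std_normal_distribution. g b y)"
    by (intro std_normal_prod.product_integral_prod assms) auto
  finally show ?thesis .
qed

lemma std_gaussian_char:
  fixes \<xi> :: "'a::euclidean_space"
  shows "(CLINT x|std_gaussian. iexp (\<xi> \<bullet> x)) = complex_of_real (exp (- ((norm \<xi>)\<^sup>2 / 2)))"
proof -
  have "(CLINT x|std_gaussian. iexp (\<xi> \<bullet> x))
      = (CLINT x|std_gaussian. (\<Prod>b\<in>Basis. iexp ((\<xi> \<bullet> b) * (x \<bullet> b))))"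
    by (subst euclidean_inner) (simp add: exp_sum sum_distrib_left mult.assoc)
  also have "\<dots> = (\<Prod>b\<in>Basis. char std_normal_distribution (\<xi> \<bullet> b))"
    unfolding char_def
    by (intro integral_std_gaussian_prod std_normal.integrable_const_bound[where B = 1]) auto
  also have "\<dots> = complex_of_real (exp (\<Sum>b\<in>Basis. - ((\<xi> \<bullet> b)\<^sup>2 / 2)))"
    by (simp add: char_std_normal_distribution exp_sum)
  also have "(\<Sum>b\<in>Basis. - ((\<xi> \<bullet> b)\<^sup>2 / 2)) = - ((norm \<xi>)\<^sup>2 / 2)"
    by (subst power2_norm_eq_inner, subst euclidean_inner)
       (simp add: sum_negf sum_divide_distrib power2_eq_square)
  finally show ?thesis .
qed

lemma nn_integral_std_normal_exp_square:
  assumes u: "0 \<le> u"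
  shows "(\<integral>\<^sup>+y. ennreal (exp (- (u * y\<^sup>2))) \<partial>std_normal_distribution) = ennreal ((1 + 2 * u) powr (- 1 / 2))"
proof -
  define \<sigma> where "\<sigma> = 1 / sqrt (1 + 2 * u)"
  have \<sigma>: "0 < \<sigma>" "\<sigma>\<^sup>2 = 1 / (1 + 2 * u)"
    using u by (auto simp: \<sigma>_def power_divide)
  interpret N: prob_space "density lborel (normal_density 0 \<sigma>)"
    by (rule prob_space_normal_density[OF \<sigma>(1)])
  have eq: "std_normal_density y * exp (- (u * y\<^sup>2)) = \<sigma> * normal_density 0 \<sigma> y" for y
  proof -
    have "exp (- y\<^sup>2 / 2) * exp (- (u * y\<^sup>2)) = exp (- (y\<^sup>2) / (2 * \<sigma>\<^sup>2))"
      unfolding \<sigma> using u by (auto simp: exp_add[symmetric] field_simps)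
    moreover have "sqrt (2 * pi * \<sigma>\<^sup>2) = sqrt (2 * pi) * \<sigma>"
      using \<sigma>(1) by (simp add: real_sqrt_mult)
    ultimately show ?thesis
      using \<sigma>(1) by (simp add: normal_density_def)
  qed
  have "(\<integral>\<^sup>+y. ennreal (exp (- (u * y\<^sup>2))) \<partial>std_normal_distribution)
      = (\<integral>\<^sup>+y. ennreal \<sigma> * ennreal (normal_density 0 \<sigma> y) \<partial>lborel)"
    using \<sigma>(1) by (subst nn_integral_density) (auto simp: ennreal_mult[symmetric] eq)
  also have "\<dots> = ennreal \<sigma> * (\<integral>\<^sup>+y. ennreal (normal_density 0 \<sigma> y) \<partial>lborel)"
    by (rule nn_integral_cmult) auto
  also have "(\<integral>\<^sup>+y. ennreal (normal_density 0 \<sigma> y) \<partial>lborel) = 1"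
    using N.emeasure_space_1 by (simp add: emeasure_density)
  also have "\<sigma> = (1 + 2 * u) powr (- 1 / 2)"
    using u by (simp add: \<sigma>_def powr_minus_divide powr_half_sqrt)
  finally show ?thesis by simp
qed

lemma nn_integral_std_gaussian_exp_norm_square:
  assumes u: "0 \<le> u"
  shows "(\<integral>\<^sup>+x. ennreal (exp (- (u * (norm x)\<^sup>2))) \<partial>(std_gaussian :: 'a measure))
         = ennreal ((1 + 2 * u) powr (- (real DIM('a::euclidean_space) / 2)))"
proof -
  have "(\<integral>\<^sup>+x. ennreal (exp (- (u * (norm x)\<^sup>2))) \<partial>(std_gaussian :: 'a measure))
      = (\<integral>\<^sup>+x. (\<Prod>b\<in>Basis. ennreal (exp (- (u * (x \<bullet> b)\<^sup>2)))) \<partial>(std_gaussian :: 'a measure))"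
    by (intro nn_integral_cong, subst power2_norm_eq_inner, subst euclidean_inner)
       (simp add: prod_ennreal exp_sum[symmetric] sum_negf sum_distrib_left power2_eq_square)
  also have "\<dots> = (\<Prod>b\<in>(Basis :: 'a set). ennreal ((1 + 2 * u) powr (- 1 / 2)))"
    by (subst nn_integral_std_gaussian_prod) (auto simp: nn_integral_std_normal_exp_square[OF u])
  also have "\<dots> = ennreal ((1 + 2 * u) powr (- (real DIM('a) / 2)))"
    using u by (simp add: ennreal_power powr_realpow[symmetric] powr_powr)
  finally show ?thesis .
qed

lemma AE_std_gaussian_nonzero: "AE x in (std_gaussian :: 'a::euclidean_space measure). x \<noteq> 0"
proof -
  obtain b :: 'a where b: "b \<in> Basis" using SOME_Basis by blast
  have "AE y in std_normal_distribution. y \<noteq> 0"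
    using AE_lborel_singleton[of "0 :: real"] by (auto simp: AE_density)
  then have "AE y in (\<Pi>\<^sub>M b\<in>(Basis :: 'a set). std_normal_distribution). y b \<noteq> 0"
    by (intro AE_PiM_component b std_normal.prob_space_axioms)
  then have "AE y in (\<Pi>\<^sub>M b\<in>(Basis :: 'a set). std_normal_distribution). (\<Sum>b\<in>Basis. y b *\<^sub>R b) \<noteq> 0"
  proof eventually_elim
    case (elim y)
    have "(\<Sum>b\<in>Basis. y b *\<^sub>R b) \<bullet> b = y b" using b by simp
    with elim show ?case by auto
  qed
  then show ?thesis
    unfolding std_gaussian_def by (subst AE_distr_iff) auto
qed

text \<open>
  A negative power of \<open>norm x\<close> is a mixture of the functions \<open>exp (- u * (norm x)\<^sup>2)\<close>:
  by the gamma integral, \<open>Gamma a * norm x powr (- 2 * a)\<close> is the integral of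
  \<open>u powr (a - 1) * exp (- u * (norm x)\<^sup>2)\<close> over \<open>u \<ge> 0\<close>. The Gaussian average of
  the integrand is \<open>u powr (a - 1) * (1 + 2 * u) powr (- D)\<close> with \<open>D\<close> half the
  dimension. Writing the second factor again as a gamma integral and exchanging the order of
  integration leaves two gamma integrals.
\<close>

lemma nn_integral_std_gaussian_norm_powr:
  assumes a: "0 \<le> a" "a < real DIM('a::euclidean_space) / 2"
  shows "(\<integral>\<^sup>+x. ennreal (norm x powr (- (2 * a))) \<partial>(std_gaussian :: 'a measure))
         = ennreal (2 powr (- a) * Gamma (real DIM('a) / 2 - a) / Gamma (real DIM('a) / 2))"
proof (cases "a = 0")
  case True
  have "(\<integral>\<^sup>+x. ennreal (norm x powr (- (2 * a))) \<partial>(std_gaussian :: 'a measure)) = (\<integral>\<^sup>+x. 1 \<partial>(std_gaussian :: 'a measure))"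
    using AE_std_gaussian_nonzero[where 'a = 'a] by (intro nn_integral_cong_AE) (auto simp: True)
  then show ?thesis
    using std_gaussian.emeasure_space_1[where 'a = 'a] Gamma_real_pos[of "real DIM('a) / 2"]
      DIM_positive[where 'a = 'a]
    by (simp add: True less_imp_neq[symmetric])
next
  case False
  with a have a0: "0 < a" by simp
  define D where "D = real DIM('a) / 2"
  have D: "0 < D" "a < D" using a by (auto simp: D_def)
  define w where "w p u = indicator {0..} u * u powr (p - 1)" for p u :: real
  have w [measurable]: "w p \<in> borel_measurable borel" for p
    unfolding w_def by measurable
  have w0: "0 \<le> w p u" for p u by (simp add: w_def)
  have gam: "(\<integral>\<^sup>+u. ennreal (w p u * exp (- (s * u))) \<partial>lborel) = ennreal (Gamma p * s powr (- p))"
    if "0 < p" "0 < s" for p s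
    using nn_integral_gamma[OF that] by (simp add: w_def)
  define I where "I = (\<integral>\<^sup>+x. ennreal (norm x powr (- (2 * a))) \<partial>(std_gaussian :: 'a measure))"
  have G: "0 < Gamma a" "0 < Gamma D" "0 < Gamma (D - a)"
    using a0 D by (auto intro: Gamma_real_pos)
  have "ennreal (Gamma a) * I = (\<integral>\<^sup>+x. ennreal (Gamma a * norm x powr (- (2 * a))) \<partial>(std_gaussian :: 'a measure))"
    unfolding I_def using G by (subst nn_integral_cmult[symmetric]) (auto simp: ennreal_mult)
  also have "\<dots> = (\<integral>\<^sup>+x. (\<integral>\<^sup>+u. ennreal (w a u * exp (- ((norm x)\<^sup>2 * u))) \<partial>lborel) \<partial>(std_gaussian :: 'a measure))"
  proof (rule nn_integral_cong_AE)
    show "AE x in (std_gaussian :: 'a measure). ennreal (Gamma a * norm x powr (- (2 * a)))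
        = (\<integral>\<^sup>+u. ennreal (w a u * exp (- ((norm x)\<^sup>2 * u))) \<partial>lborel)"
      using AE_std_gaussian_nonzero
    proof eventually_elim
      case (elim x)
      then have "((norm x)\<^sup>2) powr (- a) = norm x powr (- (2 * a))"
        using powr_powr[of "norm x" 2 "- a"] by (simp add: powr_numeral)
      with elim show ?case
        using gam[OF a0, of "(norm x)\<^sup>2"] by simp
    qed
  qed
  also have "\<dots> = (\<integral>\<^sup>+u. (\<integral>\<^sup>+x. ennreal (w a u * exp (- ((norm x)\<^sup>2 * u))) \<partial>(std_gaussian :: 'a measure)) \<partial>lborel)"
    by (rule pair_sigma_finite.Fubini'[symmetric])
       (auto intro!: pair_sigma_finite.intro std_gaussian.sigma_finite_measure_axioms sigma_finite_lborel)
  also have "\<dots> = (\<integral>\<^sup>+u. ennreal (w a u * (1 + 2 * u) powr (- D)) \<partial>lborel)"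
  proof (rule nn_integral_cong)
    fix u :: real
    show "(\<integral>\<^sup>+x. ennreal (w a u * exp (- ((norm x)\<^sup>2 * u))) \<partial>(std_gaussian :: 'a measure))
        = ennreal (w a u * (1 + 2 * u) powr (- D))"
    proof (cases "0 \<le> u")
      case True
      have "(\<integral>\<^sup>+x. ennreal (w a u * exp (- ((norm x)\<^sup>2 * u))) \<partial>(std_gaussian :: 'a measure))
          = ennreal (w a u) * (\<integral>\<^sup>+x. ennreal (exp (- (u * (norm x)\<^sup>2))) \<partial>(std_gaussian :: 'a measure))"
        using w0[of a u] by (simp add: ennreal_mult nn_integral_cmult mult.commute)
      then show ?thesis
        unfolding nn_integral_std_gaussian_exp_norm_square[OF True] D_def
        using w0 by (simp add: ennreal_mult)
    qed (simp add: w_def)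
  qed
  finally have "ennreal (Gamma D) * (ennreal (Gamma a) * I)
      = (\<integral>\<^sup>+u. ennreal (Gamma D) * ennreal (w a u * (1 + 2 * u) powr (- D)) \<partial>lborel)"
    by (simp add: nn_integral_cmult)
  also have "\<dots> = (\<integral>\<^sup>+u. ennreal (w a u * (Gamma D * (1 + 2 * u) powr (- D))) \<partial>lborel)"
    using G w0 by (intro nn_integral_cong) (auto simp: ennreal_mult[symmetric] mult_ac)
  also have "\<dots> = (\<integral>\<^sup>+u. (\<integral>\<^sup>+v. ennreal (w a u * (w D v * exp (- ((1 + 2 * u) * v)))) \<partial>lborel) \<partial>lborel)"
  proof (rule nn_integral_cong)
    fix u :: real
    show "ennreal (w a u * (Gamma D * (1 + 2 * u) powr (- D)))
       = (\<integral>\<^sup>+v. ennreal (w a u * (w D v * exp (- ((1 + 2 * u) * v)))) \<partial>lborel)"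
    proof (cases "0 \<le> u")
      case True
      then show ?thesis
        using w0 gam[of D "1 + 2 * u"] D G by (simp add: ennreal_mult nn_integral_cmult)
    qed (simp add: w_def)
  qed
  also have "\<dots> = (\<integral>\<^sup>+v. (\<integral>\<^sup>+u. ennreal (w a u * (w D v * exp (- ((1 + 2 * u) * v)))) \<partial>lborel) \<partial>lborel)"
    by (rule lborel_pair.Fubini') measurable
  also have "\<dots> = (\<integral>\<^sup>+v. ennreal (Gamma a * 2 powr (- a) * (w (D - a) v * exp (- (1 * v)))) \<partial>lborel)"
  proof (rule nn_integral_cong)
    fix v :: real
    show "(\<integral>\<^sup>+u. ennreal (w a u * (w D v * exp (- ((1 + 2 * u) * v)))) \<partial>lborel)
        = ennreal (Gamma a * 2 powr (- a) * (w (D - a) v * exp (- (1 * v))))"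
    proof (cases "0 < v")
      case True
      have "(\<integral>\<^sup>+u. ennreal (w a u * (w D v * exp (- ((1 + 2 * u) * v)))) \<partial>lborel)
          = (\<integral>\<^sup>+u. ennreal (w D v * exp (- v)) * ennreal (w a u * exp (- ((2 * v) * u))) \<partial>lborel)"
        using w0 by (intro nn_integral_cong)
          (auto simp: ennreal_mult[symmetric] exp_add[symmetric] algebra_simps exp_diff exp_minus divide_simps)
      also have "\<dots> = ennreal (w D v * exp (- v)) * ennreal (Gamma a * (2 * v) powr (- a))"
        using gam[OF a0, of "2 * v"] True by (simp add: nn_integral_cmult)
      also have "\<dots> = ennreal (Gamma a * 2 powr (- a) * (w (D - a) v * exp (- (1 * v))))"
        using True G w0 by (subst ennreal_mult[symmetric])
          (auto simp: w_def powr_mult powr_diff powr_minus field_simps powr_mult_base)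
      finally show ?thesis .
    next
      case False
      then have "w D v = 0" "w (D - a) v = 0" by (auto simp: w_def indicator_def)
      then show ?thesis by simp
    qed
  qed
  also have "\<dots> = ennreal (Gamma a * 2 powr (- a)) * ennreal (Gamma (D - a))"
    using gam[of "D - a" 1] D G w0 by (simp add: ennreal_mult nn_integral_cmult)
  finally have eq: "ennreal (Gamma D * Gamma a) * I = ennreal (Gamma a * 2 powr (- a) * Gamma (D - a))"
    using G by (simp add: ennreal_mult mult.assoc)
  have "I = ennreal (1 / (Gamma D * Gamma a)) * (ennreal (Gamma D * Gamma a) * I)"
    using G by (simp add: mult.assoc[symmetric] ennreal_mult[symmetric])
  also have "\<dots> = ennreal (2 powr (- a) * Gamma (D - a) / Gamma D)"
    unfolding eq using G by (subst ennreal_mult[symmetric]) (auto simp: field_simps)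
  finally show ?thesis
    unfolding I_def D_def .
qed

text \<open>
  The function \<open>x \<mapsto> exp (- s * (norm x)\<^sup>2)\<close> is itself the characteristic function of a
  Gaussian vector, \<open>sqrt (2 * s) *\<^sub>R y\<close> with \<open>y\<close> standard. Exchanging the two
  averages produces the characteristic function of \<open>p\<close>, evaluated at that vector.
\<close>

lemma laplace_norm_square_eq_gaussian_average:
  fixes p :: "'a::euclidean_space measure" and \<phi> :: "'a \<Rightarrow> real"
  assumes p: "prob_space p" and sets [measurable_cong]: "sets p = sets borel"
    and char: "\<And>\<xi>. (CLINT x|p. iexp (\<xi> \<bullet> x)) = complex_of_real (\<phi> \<xi>)" and s: "0 \<le> s"
  shows "(LINT x|p. exp (- (s * (norm x)\<^sup>2))) = (LINT y|std_gaussian. \<phi> (sqrt (2 * s) *\<^sub>R y))"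
proof -
  interpret p: prob_space p by fact
  interpret pair: pair_prob_space std_gaussian p ..
  have "complex_of_real (LINT x|p. exp (- (s * (norm x)\<^sup>2)))
      = (CLINT x|p. (CLINT y|std_gaussian. iexp ((sqrt (2 * s) *\<^sub>R y) \<bullet> x)))"
  proof -
    have "(CLINT y|std_gaussian. iexp ((sqrt (2 * s) *\<^sub>R y) \<bullet> x)) = complex_of_real (exp (- (s * (norm x)\<^sup>2)))"
      for x :: 'a
      using std_gaussian_char[of "sqrt (2 * s) *\<^sub>R x"] s
      by (simp add: inner_commute power_mult_distrib)
    then show ?thesis by simp
  qed
  also have "\<dots> = (CLINT y|std_gaussian. (CLINT x|p. iexp ((sqrt (2 * s) *\<^sub>R y) \<bullet> x)))"
    by (rule pair.Fubini_integral, rule pair.integrable_const_bound[where B = 1]) auto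
  also have "\<dots> = complex_of_real (LINT y|std_gaussian. \<phi> (sqrt (2 * s) *\<^sub>R y))"
    unfolding char by simp
  finally show ?thesis
    using of_real_eq_iff by blast
qed

section \<open>The radial potential of a Levy process\<close>

lemma (in levy_process) prob_space_law: "0 \<le> t \<Longrightarrow> prob_space (distr M borel (X t))"
  by (intro prob_space_distr measurable_X)

text \<open>
  By stochastic continuity, the probability that \<open>X t\<close> lies in a closed ball is an upper
  semicontinuous function of \<open>t\<close>: enlarging the ball slightly changes its probability only a
  little, and for \<open>s\<close> near \<open>t\<close> the event that \<open>X s\<close> is in the ball while \<open>X t\<close>
  is outside the enlarged ball is improbable. Superlevel sets of an upper semicontinuous function
  are closed, whence measurability.
\<close>

lemma (in levy_process) measurable_norm_square_cdf:
  "(\<lambda>t. emeasure (distr M borel (\<lambda>w. (norm (X t w))\<^sup>2)) {..c}) \<in> borel_measurable (restrict_space lborel {0..})"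
proof (cases "0 \<le> c")
  case False
  have "(\<lambda>w. (norm (X t w))\<^sup>2) -` {..c} \<inter> space M = {}" for t
    using False by (auto dest: order_trans[OF zero_le_power2])
  then have "emeasure (distr M borel (\<lambda>w. (norm (X t w))\<^sup>2)) {..c} = 0" if "0 \<le> t" for t
    using measurable_X[OF that] by (simp add: emeasure_distr)
  then show ?thesis
    by (intro measurable_cong[THEN iffD2, OF _ measurable_const[of 0]]) (auto simp: space_restrict_space)
next
  case True
  define q where "q t r = prob {w \<in> space M. norm (X t w) \<le> r}" for t r
  have ball: "{w \<in> space M. norm (X t w) \<le> r} \<in> events" if "0 \<le> t" for t r
    using measurable_X[OF that] by measurable
  have eq: "emeasure (distr M borel (\<lambda>w. (norm (X t w))\<^sup>2)) {..c} = ennreal (q t (sqrt c))" if "0 \<le> t" for t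
  proof -
    have [measurable]: "X t \<in> borel_measurable M" by (rule measurable_X[OF that])
    have "(norm v)\<^sup>2 \<le> c \<longleftrightarrow> norm v \<le> sqrt c" for v :: 'a
      using power2_le_iff_abs_le[of "sqrt c" "norm v"] True by simp
    then have "(\<lambda>w. (norm (X t w))\<^sup>2) -` {..c} \<inter> space M = {w \<in> space M. norm (X t w) \<le> sqrt c}"
      by auto
    then show ?thesis
      by (simp add: emeasure_distr q_def emeasure_eq_measure)
  qed
  \<comment> \<open>Upper semicontinuity in the form: each strict sublevel set is relatively open.\<close>
  have usc: "\<exists>T. open T \<and> t \<in> T \<and> (\<forall>s\<in>T \<inter> {0..}. q s r < y)" if t: "0 \<le> t" and y: "q t r < y" for t r y
  proof -
    have dec: "v \<le> r + 1 / real (Suc m)" if "m \<le> n" "v \<le> r + 1 / real (Suc n)" for v :: real and m n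
    proof -
      have "1 / real (Suc n) \<le> 1 / real (Suc m)" using that(1) by (simp add: frac_le)
      with that(2) show ?thesis by linarith
    qed
    have "(\<lambda>n. q t (r + 1 / real (Suc n))) \<longlonglongrightarrow> prob (\<Inter>n. {w \<in> space M. norm (X t w) \<le> r + 1 / real (Suc n)})"
      unfolding q_def
    proof (rule finite_Lim_measure_decseq)
      show "range (\<lambda>n. {w \<in> space M. norm (X t w) \<le> r + 1 / real (Suc n)}) \<subseteq> events"
        using ball[OF t] by blast
      show "decseq (\<lambda>n. {w \<in> space M. norm (X t w) \<le> r + 1 / real (Suc n)})"
        unfolding decseq_def using dec by blast
    qed
    also have "(\<Inter>n. {w \<in> space M. norm (X t w) \<le> r + 1 / real (Suc n)}) = {w \<in> space M. norm (X t w) \<le> r}"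
    proof safe
      fix w assume "w \<in> (\<Inter>n. {w \<in> space M. norm (X t w) \<le> r + 1 / real (Suc n)})"
      then have w: "w \<in> space M" "\<And>n. norm (X t w) \<le> r + 1 / real (Suc n)" by auto
      then show "w \<in> space M" "norm (X t w) \<le> r"
        using LIMSEQ_le_const[OF LIMSEQ_inverse_real_of_nat_add[of r]]
        by (auto simp: inverse_eq_divide)
    qed (auto intro: order_trans)
    finally have lim: "(\<lambda>n. q t (r + 1 / real (Suc n))) \<longlonglongrightarrow> q t r"
      unfolding q_def .
    obtain n where n: "q t (r + 1 / real (Suc n)) < y"
      using eventually_happens'[OF sequentially_bot order_tendstoD(2)[OF lim y]] by blast
    define e where "e = 1 / real (Suc n)"
    have e: "0 < e" by (simp add: e_def)
    have "\<forall>\<^sub>F s in at t within {0..}. prob {w \<in> space M. e < dist (X s w) (X t w)} < y - q t (r + e)"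
      using n by (intro order_tendstoD(2)[OF stochastically_continuous[OF t e]]) (simp add: e_def)
    then obtain T where T: "open T" "t \<in> T"
      "\<And>s. s \<in> T \<Longrightarrow> s \<noteq> t \<Longrightarrow> 0 \<le> s \<Longrightarrow> prob {w \<in> space M. e < dist (X s w) (X t w)} < y - q t (r + e)"
      unfolding eventually_at_topological by auto
    have "q s r < y" if s: "s \<in> T" "0 \<le> s" for s
    proof (cases "s = t")
      case False
      have [measurable]: "X s \<in> borel_measurable M" "X t \<in> borel_measurable M"
        by (auto intro: measurable_X s t)
      have "q s r \<le> prob ({w \<in> space M. norm (X t w) \<le> r + e} \<union> {w \<in> space M. e < dist (X s w) (X t w)})"
        unfolding q_def
      proof (rule finite_measure_mono)
        show "{w \<in> space M. norm (X s w) \<le> r}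
            \<subseteq> {w \<in> space M. norm (X t w) \<le> r + e} \<union> {w \<in> space M. e < dist (X s w) (X t w)}"
        proof safe
          fix w assume w: "norm (X s w) \<le> r" "\<not> e < dist (X s w) (X t w)"
          have "norm (X t w) \<le> norm (X s w) + dist (X s w) (X t w)"
            by (metis dist_norm norm_minus_commute norm_triangle_sub)
          with w show "norm (X t w) \<le> r + e" by simp
        qed
      qed measurable
      also have "\<dots> \<le> q t (r + e) + prob {w \<in> space M. e < dist (X s w) (X t w)}"
        unfolding q_def by (rule measure_Un_le) measurable
      also have "\<dots> < y" using T(3)[OF s(1) False s(2)] by simp
      finally show ?thesis .
    qed (use y in simp)
    with T show ?thesis by auto
  qed
  have "(\<lambda>t. q t (sqrt c)) \<in> borel_measurable (restrict_space lborel {0..})"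
    unfolding borel_measurable_iff_less
  proof safe
    fix y
    define Q where "Q = \<Union>{T. open T \<and> (\<forall>s\<in>T \<inter> {0..}. q s (sqrt c) < y)}"
    have "open Q" unfolding Q_def by auto
    have eq: "{t \<in> space (restrict_space lborel {0..}). q t (sqrt c) < y} = {0..} \<inter> Q"
    proof safe
      fix t assume "t \<in> space (restrict_space lborel {0..})" "q t (sqrt c) < y"
      then show "t \<in> Q" "0 \<le> t" using usc[of t "sqrt c" y] by (auto simp: Q_def space_restrict_space)
    qed (auto simp: Q_def space_restrict_space)
    show "{t \<in> space (restrict_space lborel {0..}). q t (sqrt c) < y} \<in> sets (restrict_space lborel {0..})"
      unfolding eq sets_restrict_space using \<open>open Q\<close> by (intro image_eqI[of _ _ Q]) auto
  qed
  then have "(\<lambda>t. ennreal (q t (sqrt c))) \<in> borel_measurable (restrict_space lborel {0..})"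
    by measurable
  then show ?thesis
    by (rule measurable_cong[THEN iffD1, rotated]) (auto simp: eq space_restrict_space)
qed

text \<open>
  The image of the potential measure under \<open>x \<mapsto> (norm x)\<^sup>2\<close>, built as a genuine measure by
  integrating the kernel \<open>t \<mapsto> law of (norm (X t))\<^sup>2\<close> over time. This reduces measurability
  questions to the dependence of one-time distribution functions on \<open>t\<close>.
\<close>

definition (in levy_process) square_potential :: "real measure" where
  "square_potential = restrict_space lborel {0..} \<bind> (\<lambda>t. distr M borel (\<lambda>w. (norm (X t w))\<^sup>2))"

lemma (in levy_process) measurable_square_kernel:
  "(\<lambda>t. distr M borel (\<lambda>w. (norm (X t w))\<^sup>2)) \<in> measurable (restrict_space lborel {0..}) (subprob_algebra borel)"
proof (rule measurable_subprob_algebra_generated[where \<Omega> = UNIV and G = "range atMost"])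
  show "sets borel = sigma_sets UNIV (range atMost :: real set set)"
    by (simp add: borel_eq_atMost)
  show "Int_stable (range atMost :: real set set)"
    by (auto simp: Int_stable_def)
  have prob: "prob_space (distr M borel (\<lambda>w. (norm (X t w))\<^sup>2))" if "t \<in> space (restrict_space lborel {0..})" for t
    using measurable_X[of t] that by (intro prob_space_distr) (auto simp: space_restrict_space)
  show "subprob_space (distr M borel (\<lambda>w. (norm (X t w))\<^sup>2))" if "t \<in> space (restrict_space lborel {0..})" for t
    using prob[OF that] by (rule prob_space_imp_subprob_space)
  show "(\<lambda>t. emeasure (distr M borel (\<lambda>w. (norm (X t w))\<^sup>2)) UNIV) \<in> borel_measurable (restrict_space lborel {0..})"
    using prob_space.emeasure_space_1[OF prob]
    by (intro measurable_cong[THEN iffD2, OF _ measurable_const[of 1]]) auto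
qed (use measurable_norm_square_cdf in auto)

lemma (in levy_process) sets_square_potential [simp, measurable_cong]: "sets square_potential = sets borel"
  unfolding square_potential_def by (intro sets_bind) (auto simp: space_restrict_space)

lemma (in levy_process) nn_integral_square_potential:
  assumes [measurable]: "f \<in> borel_measurable borel"
  shows "(\<integral>\<^sup>+z. f z \<partial>square_potential)
       = (\<integral>\<^sup>+t. (\<integral>\<^sup>+w. f ((norm (X t w))\<^sup>2) \<partial>M) * indicator {0..} t \<partial>lborel)"
proof -
  have "(\<integral>\<^sup>+z. f z \<partial>square_potential)
      = (\<integral>\<^sup>+t. (\<integral>\<^sup>+z. f z \<partial>distr M borel (\<lambda>w. (norm (X t w))\<^sup>2)) \<partial>restrict_space lborel {0..})"
    unfolding square_potential_def by (rule nn_integral_bind[OF _ measurable_square_kernel]) simp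
  also have "\<dots> = (\<integral>\<^sup>+t. (\<integral>\<^sup>+w. f ((norm (X t w))\<^sup>2) \<partial>M) \<partial>restrict_space lborel {0..})"
    using measurable_X by (intro nn_integral_cong nn_integral_distr) (auto simp: space_restrict_space)
  also have "\<dots> = (\<integral>\<^sup>+t. (\<integral>\<^sup>+w. f ((norm (X t w))\<^sup>2) \<partial>M) * indicator {0..} t \<partial>lborel)"
    by (rule nn_integral_restrict_space) simp
  finally show ?thesis .
qed

lemma (in levy_process) potential_measure_cball:
  assumes r: "0 \<le> r"
  shows "potential_measure M X {x. norm x \<le> r} = emeasure square_potential {..r\<^sup>2}"
proof -
  have "emeasure square_potential {..r\<^sup>2} = (\<integral>\<^sup>+z. indicator {..r\<^sup>2} z \<partial>square_potential)"
    by simp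
  also have "\<dots> = (\<integral>\<^sup>+t. (\<integral>\<^sup>+w. indicator {..r\<^sup>2} ((norm (X t w))\<^sup>2) \<partial>M) * indicator {0..} t \<partial>lborel)"
    by (rule nn_integral_square_potential) simp
  also have "\<dots> = (\<integral>\<^sup>+t. emeasure M {w \<in> space M. X t w \<in> {x. norm x \<le> r}} * indicator {0..} t \<partial>lborel)"
  proof (rule nn_integral_cong)
    fix t :: real
    show "(\<integral>\<^sup>+w. indicator {..r\<^sup>2} ((norm (X t w))\<^sup>2) \<partial>M) * indicator {0..} t
        = emeasure M {w \<in> space M. X t w \<in> {x. norm x \<le> r}} * indicator {0..} t"
    proof (cases "0 \<le> t")
      case True
      have [measurable]: "X t \<in> borel_measurable M" by (rule measurable_X[OF True])
      have "(\<integral>\<^sup>+w. indicator {..r\<^sup>2} ((norm (X t w))\<^sup>2) \<partial>M)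
          = (\<integral>\<^sup>+w. indicator {w \<in> space M. norm (X t w) \<le> r} w \<partial>M)"
        using r by (intro nn_integral_cong) (auto simp: indicator_def power2_le_iff_abs_le)
      also have "\<dots> = emeasure M {w \<in> space M. norm (X t w) \<le> r}"
        by (rule nn_integral_indicator) measurable
      finally show ?thesis by simp
    qed simp
  qed
  finally show ?thesis by (simp add: potential_measure_def)
qed

lemma (in levy_process) AE_square_potential_nonneg: "AE z in square_potential. 0 \<le> z"
proof -
  have "emeasure square_potential {..<0} = (\<integral>\<^sup>+z. indicator {..<0} z \<partial>square_potential)" by simp
  also have "\<dots> = 0" by (subst nn_integral_square_potential) auto
  finally show ?thesis by (intro AE_I[where N = "{..<0}"]) auto
qed

section \<open>Growth of isotropic Levy exponents\<close>

text \<open>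
  In terms of half angles, \<open>1 - cos x = 2 * (sin (x / 2))\<^sup>2\<close> and
  \<open>\<bar>sin (a + b)\<bar> \<le> \<bar>sin a\<bar> + \<bar>sin b\<bar>\<close>: the square root of \<open>1 - cos\<close> is
  subadditive.
\<close>

lemma one_minus_cos_add_le: "1 - cos (x + y) \<le> 2 * (1 - cos x) + 2 * (1 - cos y)" for x y :: real
proof -
  define a b where "a = x / 2" and "b = y / 2"
  have *: "1 - cos (2 * c) = 2 * (sin c)\<^sup>2" for c :: real
    by (simp add: cos_double_sin)
  have "\<bar>sin (a + b)\<bar> \<le> \<bar>sin a\<bar> + \<bar>sin b\<bar>"
  proof -
    have "\<bar>sin (a + b)\<bar> \<le> \<bar>sin a\<bar> * \<bar>cos b\<bar> + \<bar>cos a\<bar> * \<bar>sin b\<bar>"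
      unfolding sin_add by (metis abs_mult abs_triangle_ineq)
    also have "\<dots> \<le> \<bar>sin a\<bar> * 1 + 1 * \<bar>sin b\<bar>"
      by (intro add_mono mult_mono) auto
    finally show ?thesis by simp
  qed
  then have "(sin (a + b))\<^sup>2 \<le> (\<bar>sin a\<bar> + \<bar>sin b\<bar>)\<^sup>2"
    by (metis abs_ge_zero power2_abs power_mono)
  also have "\<dots> \<le> 2 * (sin a)\<^sup>2 + 2 * (sin b)\<^sup>2"
    using sum_squares_bound[of "\<bar>sin a\<bar>" "\<bar>sin b\<bar>"] by (simp add: power2_sum)
  finally have le: "(sin (a + b))\<^sup>2 \<le> 2 * (sin a)\<^sup>2 + 2 * (sin b)\<^sup>2" .
  have "x = 2 * a" "y = 2 * b" "x + y = 2 * (a + b)"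
    by (simp_all add: a_def b_def)
  then have "1 - cos x = 2 * (sin a)\<^sup>2" "1 - cos y = 2 * (sin b)\<^sup>2" "1 - cos (x + y) = 2 * (sin (a + b))\<^sup>2"
    by (simp_all only: *)
  with le show ?thesis by simp
qed

lemma tendsto_one_minus_exp_quotient:
  "((\<lambda>t. (1 - exp (- t * c)) / t) \<longlongrightarrow> c) (at_right 0)" for c :: real
proof -
  have "((\<lambda>t. 1 - exp (- t * c)) has_real_derivative c) (at 0)"
    by (auto intro!: derivative_eq_intros)
  then have "((\<lambda>t. (1 - exp (- t * c)) / t) \<longlongrightarrow> c) (at 0)"
    by (simp add: has_field_derivative_iff)
  then show ?thesis by (rule tendsto_mono[rotated]) (simp add: at_le)
qed

text \<open>
  The exponent is tied to the process by its characteristic functions. Two dimensions are required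
  so that any vector of length at most \<open>2 * u\<close> is a sum of two vectors of length \<open>u\<close>.
\<close>

locale isotropic_exponent = isotropic_levy_process M X
  for M :: "'w measure" and X :: "real \<Rightarrow> 'w \<Rightarrow> real ^ 'n" +
  fixes \<psi> :: "real ^ 'n \<Rightarrow> real"
  assumes dim: "2 \<le> CARD('n)"
    and char: "0 \<le> t \<Longrightarrow>
      (CLINT x|distr M borel (X t). iexp (\<xi> \<bullet> x)) = complex_of_real (exp (- t * \<psi> \<xi>))"
begin

abbreviation \<Psi> :: "real \<Rightarrow> real" where
  "\<Psi> \<equiv> radial_profile \<psi>"

lemma cos_integral:
  assumes "0 \<le> t"
  shows "(LINT x|distr M borel (X t). cos (\<xi> \<bullet> x)) = exp (- t * \<psi> \<xi>)"
proof -
  interpret p: prob_space "distr M borel (X t)" by (rule prob_space_law[OF assms])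
  have "integrable (distr M borel (X t)) (\<lambda>x. iexp (\<xi> \<bullet> x))"
    by (rule p.integrable_const_bound[where B = 1]) auto
  from integral_Re[OF this] show ?thesis
    by (simp add: char[OF assms] Re_exp)
qed

lemma exponent_nonneg: "0 \<le> \<psi> \<xi>"
proof -
  interpret p: prob_space "distr M borel (X 1)" by (rule prob_space_law) simp
  have "(LINT x|distr M borel (X 1). cos (\<xi> \<bullet> x)) \<le> 1"
    by (rule p.integral_le_const) (auto intro!: p.integrable_const_bound[where B = 1])
  then show ?thesis by (simp add: cos_integral)
qed

text \<open>
  The inequality for \<open>1 - cos\<close>, averaged over the law of \<open>X t\<close>, bounds
  \<open>1 - exp (- t * \<psi> (\<xi> + \<zeta>))\<close>; dividing by \<open>t\<close> and letting \<open>t\<close> tend to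
  \<open>0\<close> transfers it to the exponent.
\<close>

lemma exponent_add_le: "\<psi> (\<xi> + \<zeta>) \<le> 2 * \<psi> \<xi> + 2 * \<psi> \<zeta>"
proof (rule tendsto_le)
  show "((\<lambda>t. (1 - exp (- t * \<psi> (\<xi> + \<zeta>))) / t) \<longlongrightarrow> \<psi> (\<xi> + \<zeta>)) (at_right 0)"
    by (rule tendsto_one_minus_exp_quotient)
  show "((\<lambda>t. 2 * ((1 - exp (- t * \<psi> \<xi>)) / t) + 2 * ((1 - exp (- t * \<psi> \<zeta>)) / t))
      \<longlongrightarrow> 2 * \<psi> \<xi> + 2 * \<psi> \<zeta>) (at_right 0)"
    by (intro tendsto_intros tendsto_one_minus_exp_quotient)
  show "\<forall>\<^sub>F t in at_right 0. (1 - exp (- t * \<psi> (\<xi> + \<zeta>))) / t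
      \<le> 2 * ((1 - exp (- t * \<psi> \<xi>)) / t) + 2 * ((1 - exp (- t * \<psi> \<zeta>)) / t)"
    using eventually_at_right_less[of "0 :: real"]
  proof eventually_elim
    case (elim t)
    let ?p = "distr M borel (X t)"
    interpret p: prob_space ?p by (rule prob_space_law) (use elim in simp)
    have int: "integrable ?p (\<lambda>x. cos (\<eta> \<bullet> x))" for \<eta>
      by (rule p.integrable_const_bound[where B = 1]) auto
    have E: "(LINT x|?p. 1 - cos (\<eta> \<bullet> x)) = 1 - exp (- t * \<psi> \<eta>)" for \<eta>
      using int[of \<eta>] elim cos_integral[of t \<eta>] p.prob_space by simp
    have "(LINT x|?p. 1 - cos ((\<xi> + \<zeta>) \<bullet> x))
        \<le> (LINT x|?p. 2 * (1 - cos (\<xi> \<bullet> x)) + 2 * (1 - cos (\<zeta> \<bullet> x)))"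
      by (intro integral_mono Bochner_Integration.integrable_diff Bochner_Integration.integrable_add
            integrable_mult_right int p.integrable_const)
         (unfold inner_add_left, rule one_minus_cos_add_le)
    also have "\<dots> = 2 * (LINT x|?p. 1 - cos (\<xi> \<bullet> x)) + 2 * (LINT x|?p. 1 - cos (\<zeta> \<bullet> x))"
      using int by simp
    finally have le: "1 - exp (- t * \<psi> (\<xi> + \<zeta>)) \<le> 2 * (1 - exp (- t * \<psi> \<xi>)) + 2 * (1 - exp (- t * \<psi> \<zeta>))"
      unfolding E .
    show ?case
      using divide_right_mono[OF le less_imp_le[OF elim]]
      by (simp only: times_divide_eq_right add_divide_distrib)
  qed
qed simp

lemma exponent_radial:
  assumes "norm \<xi> = norm \<zeta>"
  shows "\<psi> \<xi> = \<psi> \<zeta>"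
proof -
  let ?p = "distr M borel (X 1)"
  obtain U where U: "orthogonal_transformation U" "U \<zeta> = \<xi>"
    using orthogonal_transformation_exists assms by metis
  have [measurable]: "U \<in> borel_measurable borel"
    by (intro borel_measurable_continuous_onI linear_continuous_on linear_linear[THEN iffD2]
        orthogonal_transformation_linear U)
  have "distr ?p borel U = ?p"
    using isotropic[of 1] U(1) by (simp add: rotation_invariant_def)
  then have "(LINT x|?p. cos (\<xi> \<bullet> x)) = (LINT x|distr ?p borel U. cos (\<xi> \<bullet> x))"
    by simp
  also have "\<dots> = (LINT x|?p. cos (\<xi> \<bullet> U x))"
    by (rule integral_distr) measurable
  also have "\<dots> = (LINT x|?p. cos (\<zeta> \<bullet> x))"
    using U unfolding orthogonal_transformation_def by metis
  finally show ?thesis by (simp add: cos_integral)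
qed

lemma radial_profile_norm: "\<Psi> (norm \<xi>) = \<psi> \<xi>"
  unfolding radial_profile_def
proof (rule the_equality)
  show "\<forall>\<zeta>. norm \<zeta> = norm \<xi> \<longrightarrow> \<psi> \<zeta> = \<psi> \<xi>"
    using exponent_radial by blast
qed simp

lemma exponent_measurable [measurable]: "\<psi> \<in> borel_measurable borel"
proof -
  interpret p: prob_space "distr M borel (X 1)" by (rule prob_space_law) simp
  have "(\<lambda>\<xi>. - ln (LINT x|distr M borel (X 1). cos (\<xi> \<bullet> x))) \<in> borel_measurable borel"
    by measurable
  then show ?thesis by (simp add: cos_integral)
qed

text \<open>
  A vector of length \<open>v\<close> is the sum of two vectors of length \<open>u\<close>, the equal sides of an
  isosceles triangle with base \<open>v\<close>. So quasi-subadditivity compares the profile at \<open>u\<close>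
  not just with its value at \<open>2 * u\<close> but with its values on all of \<open>[0, 2 * u]\<close>.
\<close>

lemma radial_profile_doubling:
  assumes "0 \<le> v" "v \<le> 2 * u"
  shows "\<Psi> v \<le> 4 * \<Psi> u"
proof -
  have "\<not> (\<forall>j. j = (undefined :: 'n))"
  proof
    assume "\<forall>j. j = (undefined :: 'n)"
    then have "(UNIV :: 'n set) = {undefined}" by auto
    then have "CARD('n) = 1" by (metis card_1_singleton_iff One_nat_def)
    with dim show False by simp
  qed
  then obtain i j :: 'n where ij: "i \<noteq> j" by blast
  define h where "h = sqrt (u\<^sup>2 - (v / 2)\<^sup>2)"
  have "(v / 2)\<^sup>2 \<le> u\<^sup>2" using assms by (intro power_mono) auto
  then have h: "h\<^sup>2 = u\<^sup>2 - (v / 2)\<^sup>2" by (simp add: h_def)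
  define \<xi> \<zeta> where "\<xi> = (v / 2) *\<^sub>R axis i 1 + h *\<^sub>R (axis j 1 :: real ^ 'n)"
    and "\<zeta> = (v / 2) *\<^sub>R axis i 1 - h *\<^sub>R (axis j 1 :: real ^ 'n)"
  have ax: "axis i (1::real) \<bullet> axis i 1 = 1" "axis j (1::real) \<bullet> axis j 1 = 1"
     "axis i (1::real) \<bullet> axis j 1 = 0" "axis j (1::real) \<bullet> axis i 1 = 0"
    using ij by (auto simp: inner_axis_axis)
  have "(norm \<xi>)\<^sup>2 = u\<^sup>2" "(norm \<zeta>)\<^sup>2 = u\<^sup>2"
    using h unfolding power2_norm_eq_inner \<xi>_def \<zeta>_def
    by (simp_all add: inner_simps ax power2_eq_square)
  moreover have "0 \<le> u" using assms by simp
  ultimately have n: "norm \<xi> = u" "norm \<zeta> = u" by (auto intro: power2_eq_imp_eq)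
  have "\<xi> + \<zeta> = v *\<^sub>R axis i 1"
    by (simp add: \<xi>_def \<zeta>_def vec_eq_iff axis_def)
  then have "norm (\<xi> + \<zeta>) = v" using assms by (simp add: norm_axis_1)
  with exponent_add_le[of \<xi> \<zeta>] show ?thesis
    using n radial_profile_norm[of \<xi>] radial_profile_norm[of \<zeta>] radial_profile_norm[of "\<xi> + \<zeta>"] by simp
qed

lemma radial_profile_nonneg: "0 \<le> u \<Longrightarrow> 0 \<le> \<Psi> u"
  using exponent_nonneg[of "u *\<^sub>R axis undefined 1"] radial_profile_norm[of "u *\<^sub>R axis undefined 1"]
  by (simp add: norm_axis_1)

text \<open>
  A substitute for the Potter bounds of regularly varying functions, valid at all scales at once.
  The exponent \<open>2\<close> comes from iterating the doubling inequality with factor \<open>4 = 2\<^sup>2\<close>. It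
  is small enough for \<open>norm y powr (- 2)\<close> to be Gaussian integrable in dimension three and
  higher.
\<close>

lemma radial_profile_growth:
  assumes u: "0 < u" and R: "0 \<le> R"
  shows "\<Psi> R \<le> 4 * (1 + (R / u)\<^sup>2) * \<Psi> u"
proof -
  \<comment> \<open>For \<open>R \<ge> u\<close> the bound holds without the summand \<open>1\<close>, and in this form it survives the halving of \<open>R\<close>.\<close>
  have growth: "u \<le> R \<Longrightarrow> R \<le> 2 ^ Suc k * u \<Longrightarrow> \<Psi> R \<le> 4 * (R / u)\<^sup>2 * \<Psi> u" for k R
  proof (induction k arbitrary: R)
    case 0
    have "\<Psi> R \<le> 4 * 1 * \<Psi> u" using radial_profile_doubling[of R u] 0 u by simp
    also have "\<dots> \<le> 4 * (R / u)\<^sup>2 * \<Psi> u"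
      using 0 u radial_profile_nonneg[of u] by (intro mult_right_mono mult_left_mono) auto
    finally show ?case .
  next
    case (Suc k)
    show ?case
    proof (cases "R \<le> 2 * u")
      case True
      have "\<Psi> R \<le> 4 * 1 * \<Psi> u" using radial_profile_doubling[of R u] Suc.prems True u by simp
      also have "\<dots> \<le> 4 * (R / u)\<^sup>2 * \<Psi> u"
        using Suc.prems u radial_profile_nonneg[of u] by (intro mult_right_mono mult_left_mono) auto
      finally show ?thesis .
    next
      case False
      have "\<Psi> R \<le> 4 * \<Psi> (R / 2)" using radial_profile_doubling[of R "R / 2"] Suc.prems u by simp
      also have "\<Psi> (R / 2) \<le> 4 * (R / 2 / u)\<^sup>2 * \<Psi> u"
        using Suc.IH[of "R / 2"] Suc.prems False by simp
      finally show ?thesis by (simp add: power_divide)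
    qed
  qed
  show ?thesis
  proof (cases "u \<le> R")
    case True
    obtain k where "R / u < 2 ^ k" using real_arch_pow[of 2 "R / u"] by auto
    then have "R \<le> 2 ^ k * u" using u by (simp add: field_simps)
    also have "\<dots> \<le> 2 ^ Suc k * u" using u by simp
    finally have "\<Psi> R \<le> 4 * (R / u)\<^sup>2 * \<Psi> u" using growth True by blast
    also have "\<dots> \<le> 4 * (1 + (R / u)\<^sup>2) * \<Psi> u"
      using u radial_profile_nonneg[of u] by (intro mult_right_mono) auto
    finally show ?thesis .
  next
    case False
    have "\<Psi> R \<le> 4 * 1 * \<Psi> u" using radial_profile_doubling[of R u] R False u by simp
    also have "\<dots> \<le> 4 * (1 + (R / u)\<^sup>2) * \<Psi> u"
      using u radial_profile_nonneg[of u] by (intro mult_right_mono mult_left_mono) auto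
    finally show ?thesis .
  qed
qed

text \<open>
  Each law is averaged against a Gaussian characteristic function, and then
  \<open>exp (- t * \<psi> \<xi>)\<close> integrates over time to \<open>1 / \<psi> \<xi>\<close>. At \<open>y = 0\<close> the
  exponent vanishes and the time integral diverges, but the Gaussian law does not charge the origin.
\<close>

lemma laplace_square_potential:
  assumes pos: "\<And>u. 0 < u \<Longrightarrow> 0 < \<Psi> u" and s: "0 < s"
  shows "(\<integral>\<^sup>+z. ennreal (exp (- (s * z))) \<partial>square_potential)
       = (\<integral>\<^sup>+y. ennreal (1 / \<psi> (sqrt (2 * s) *\<^sub>R y)) \<partial>(std_gaussian :: (real ^ 'n) measure))"
proof -
  let ?N = "std_gaussian :: (real ^ 'n) measure"
  have "(\<integral>\<^sup>+z. ennreal (exp (- (s * z))) \<partial>square_potential)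
      = (\<integral>\<^sup>+t. (\<integral>\<^sup>+w. ennreal (exp (- (s * (norm (X t w))\<^sup>2))) \<partial>M) * indicator {0..} t \<partial>lborel)"
    by (rule nn_integral_square_potential) measurable
  also have "\<dots> = (\<integral>\<^sup>+t. (\<integral>\<^sup>+y. ennreal (indicator {0..} t * exp (- (\<psi> (sqrt (2 * s) *\<^sub>R y) * t))) \<partial>?N) \<partial>lborel)"
  proof (rule nn_integral_cong)
    fix t :: real
    show "(\<integral>\<^sup>+w. ennreal (exp (- (s * (norm (X t w))\<^sup>2))) \<partial>M) * indicator {0..} t
        = (\<integral>\<^sup>+y. ennreal (indicator {0..} t * exp (- (\<psi> (sqrt (2 * s) *\<^sub>R y) * t))) \<partial>?N)"
    proof (cases "0 \<le> t")
      case True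
      let ?p = "distr M borel (X t)"
      interpret p: prob_space ?p by (rule prob_space_law[OF True])
      have [measurable]: "X t \<in> borel_measurable M" by (rule measurable_X[OF True])
      have "(\<integral>\<^sup>+w. ennreal (exp (- (s * (norm (X t w))\<^sup>2))) \<partial>M) = (\<integral>\<^sup>+x. ennreal (exp (- (s * (norm x)\<^sup>2))) \<partial>?p)"
        by (simp add: nn_integral_distr)
      also have "\<dots> = ennreal (LINT x|?p. exp (- (s * (norm x)\<^sup>2)))"
        using s by (intro nn_integral_eq_integral p.integrable_const_bound[where B = 1]) auto
      also have "\<dots> = ennreal (LINT y|?N. exp (- t * \<psi> (sqrt (2 * s) *\<^sub>R y)))"
        using s by (subst laplace_norm_square_eq_gaussian_average[OF p.prob_space_axioms _ char[OF True]]) auto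
      also have "\<dots> = (\<integral>\<^sup>+y. ennreal (exp (- t * \<psi> (sqrt (2 * s) *\<^sub>R y))) \<partial>?N)"
        using True exponent_nonneg
        by (intro nn_integral_eq_integral[symmetric] std_gaussian.integrable_const_bound[where B = 1]) auto
      finally show ?thesis using True by (simp add: mult.commute)
    qed simp
  qed
  also have "\<dots> = (\<integral>\<^sup>+y. (\<integral>\<^sup>+t. ennreal (indicator {0..} t * exp (- (\<psi> (sqrt (2 * s) *\<^sub>R y) * t))) \<partial>lborel) \<partial>?N)"
    by (rule pair_sigma_finite.Fubini'[symmetric])
       (auto intro!: pair_sigma_finite.intro std_gaussian.sigma_finite_measure_axioms sigma_finite_lborel)
  also have "\<dots> = (\<integral>\<^sup>+y. ennreal (1 / \<psi> (sqrt (2 * s) *\<^sub>R y)) \<partial>?N)"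
  proof (rule nn_integral_cong_AE)
    show "AE y in ?N. (\<integral>\<^sup>+t. ennreal (indicator {0..} t * exp (- (\<psi> (sqrt (2 * s) *\<^sub>R y) * t))) \<partial>lborel)
        = ennreal (1 / \<psi> (sqrt (2 * s) *\<^sub>R y))"
      using AE_std_gaussian_nonzero
    proof eventually_elim
      case (elim y)
      have "0 < \<psi> (sqrt (2 * s) *\<^sub>R y)"
        using pos[of "norm (sqrt (2 * s) *\<^sub>R y)"] elim s unfolding radial_profile_norm by simp
      note nn_integral_gamma[OF zero_less_one this]
      moreover have "(\<integral>\<^sup>+t. ennreal (indicator {0..} t * exp (- (\<psi> (sqrt (2 * s) *\<^sub>R y) * t))) \<partial>lborel)
        = (\<integral>\<^sup>+t. ennreal (indicator {0..} t * t powr (1 - 1) * exp (- (\<psi> (sqrt (2 * s) *\<^sub>R y) * t))) \<partial>lborel)"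
        using AE_lborel_singleton[of "0 :: real"] by (intro nn_integral_cong_AE) auto
      ultimately show ?case
        using \<open>0 < \<psi> (sqrt (2 * s) *\<^sub>R y)\<close> by (simp add: powr_minus_divide)
    qed
  qed
  finally show ?thesis .
qed

end

section \<open>Asymptotics of the Laplace transform of the potential\<close>

context isotropic_exponent
begin

lemma exponent_scaled:
  assumes "0 < s" "0 < K"
  shows "\<psi> (sqrt (2 * (K * s)) *\<^sub>R y) = \<Psi> ((sqrt (2 * K) * norm y) * sqrt s)"
proof -
  have "norm (sqrt (2 * (K * s)) *\<^sub>R y) = (sqrt (2 * K) * norm y) * sqrt s"
    using assms by (simp add: real_sqrt_mult)
  then show ?thesis by (metis radial_profile_norm)
qed

lemma exponent_ratio_bound:
  assumes pos: "\<And>u. 0 < u \<Longrightarrow> 0 < \<Psi> u" and s: "0 < s" and K: "1 \<le> K" and y: "y \<noteq> 0"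
  shows "norm (\<Psi> (sqrt s) / \<psi> (sqrt (2 * (K * s)) *\<^sub>R y)) \<le> 4 * (1 + norm y powr (- 2))"
proof -
  define u where "u = (sqrt (2 * K) * norm y) * sqrt s"
  have u: "0 < u" using y s K by (simp add: u_def)
  have "\<Psi> (sqrt s) \<le> 4 * (1 + (sqrt s / u)\<^sup>2) * \<Psi> u"
    by (rule radial_profile_growth[OF u]) (use s in simp)
  then have "\<Psi> (sqrt s) / \<Psi> u \<le> 4 * (1 + (sqrt s / u)\<^sup>2)"
    using pos[OF u] by (simp add: divide_le_eq)
  also have "(sqrt s / u)\<^sup>2 = 1 / (2 * K) * norm y powr (- 2)"
    using s K y
    by (simp add: u_def power_divide power_mult_distrib powr_minus powr_numeral field_simps)
  also have "4 * (1 + 1 / (2 * K) * norm y powr (- 2)) \<le> 4 * (1 + 1 * norm y powr (- 2))"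
    using K by (intro mult_left_mono add_mono mult_right_mono) auto
  finally have "\<Psi> (sqrt s) / \<Psi> u \<le> 4 * (1 + norm y powr (- 2))"
    by simp
  moreover have "0 \<le> \<Psi> (sqrt s) / \<Psi> u"
    using u s by (intro divide_nonneg_nonneg radial_profile_nonneg) auto
  ultimately show ?thesis
    using exponent_scaled[OF s, of K y] K by (simp add: u_def)
qed

lemma integrable_exponent_ratio_bound:
  assumes dim3: "3 \<le> CARD('n)"
  shows "integrable (std_gaussian :: (real ^ 'n) measure) (\<lambda>y. 4 * (1 + norm y powr (- 2)))"
proof -
  have "(\<integral>\<^sup>+y. ennreal (norm y powr (- (2 * 1))) \<partial>(std_gaussian :: (real ^ 'n) measure)) < \<infinity>"
    using dim3 by (subst nn_integral_std_gaussian_norm_powr) auto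
  then have "integrable (std_gaussian :: (real ^ 'n) measure) (\<lambda>y. norm y powr (- 2))"
    by (intro integrableI_nonneg) auto
  then show ?thesis by simp
qed

text \<open>
  Regular variation gives the pointwise limit for \<open>y \<noteq> 0\<close>. The growth bound gives an
  integrable majorant, uniformly over all frequencies, including the low ones, where regular
  variation at infinity gives no information.
\<close>

lemma exponent_ratio_gaussian_limit:
  assumes dim3: "3 \<le> CARD('n)" and pos: "\<And>u. 0 < u \<Longrightarrow> 0 < \<Psi> u"
    and rv: "\<And>b. 0 < b \<Longrightarrow> ((\<lambda>x. \<Psi> (b * x) / \<Psi> x) \<longlongrightarrow> b powr \<alpha>) at_top"
    and K: "1 \<le> K"
  shows "((\<lambda>s. LINT y|(std_gaussian :: (real ^ 'n) measure). \<Psi> (sqrt s) / \<psi> (sqrt (2 * (K * s)) *\<^sub>R y))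
     \<longlongrightarrow> (LINT y|(std_gaussian :: (real ^ 'n) measure). (sqrt (2 * K) * norm y) powr (- \<alpha>))) at_top"
proof (rule integral_dominated_convergence_at_top)
  let ?N = "std_gaussian :: (real ^ 'n) measure"
  show "integrable ?N (\<lambda>y. 4 * (1 + norm y powr (- 2)))"
    by (rule integrable_exponent_ratio_bound[OF dim3])
  show "AE y in ?N. ((\<lambda>s. \<Psi> (sqrt s) / \<psi> (sqrt (2 * (K * s)) *\<^sub>R y))
      \<longlongrightarrow> (sqrt (2 * K) * norm y) powr (- \<alpha>)) at_top"
    using AE_std_gaussian_nonzero
  proof eventually_elim
    case (elim y)
    define b where "b = sqrt (2 * K) * norm y"
    have b: "0 < b" using elim K by (simp add: b_def)
    have "((\<lambda>s. inverse (\<Psi> (b * sqrt s) / \<Psi> (sqrt s))) \<longlongrightarrow> inverse (b powr \<alpha>)) at_top"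
      using b by (intro tendsto_inverse filterlim_compose[OF rv sqrt_at_top]) auto
    moreover have "\<forall>\<^sub>F s in at_top. inverse (\<Psi> (b * sqrt s) / \<Psi> (sqrt s))
        = \<Psi> (sqrt s) / \<psi> (sqrt (2 * (K * s)) *\<^sub>R y)"
      using eventually_gt_at_top[of 0]
      by eventually_elim (use K in \<open>simp add: exponent_scaled b_def del: real_sqrt_mult\<close>)
    ultimately show ?case
      unfolding b_def[symmetric] powr_minus by (rule Lim_transform_eventually)
  qed
  show "\<forall>\<^sub>F s in at_top. AE y in ?N. norm (\<Psi> (sqrt s) / \<psi> (sqrt (2 * (K * s)) *\<^sub>R y)) \<le> 4 * (1 + norm y powr (- 2))"
    using eventually_gt_at_top[of 0]
  proof eventually_elim
    case (elim s)
    show ?case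
      using AE_std_gaussian_nonzero
      by eventually_elim (rule exponent_ratio_bound[OF pos elim K])
  qed
qed measurable

lemma gaussian_limit_value:
  assumes dim3: "3 \<le> CARD('n)" and \<alpha>: "0 \<le> \<alpha>" "\<alpha> \<le> 2" and K: "0 < K"
  shows "(LINT y|(std_gaussian :: (real ^ 'n) measure). (sqrt (2 * K) * norm y) powr (- \<alpha>))
     = 2 powr (- \<alpha>) * Gamma ((real CARD('n) - \<alpha>) / 2) / Gamma (real CARD('n) / 2) * K powr (- (\<alpha> / 2))"
proof -
  let ?N = "std_gaussian :: (real ^ 'n) measure"
  have G: "0 \<le> Gamma ((real CARD('n) - \<alpha>) / 2)" "0 \<le> Gamma (real CARD('n) / 2)"
    using dim3 \<alpha> by (auto intro!: less_imp_le Gamma_real_pos)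
  have "(LINT y|?N. norm y powr (- \<alpha>)) = enn2real (\<integral>\<^sup>+y. ennreal (norm y powr (- (2 * (\<alpha> / 2)))) \<partial>?N)"
    by (subst integral_eq_nn_integral) auto
  also have "\<dots> = 2 powr (- (\<alpha> / 2)) * Gamma ((real CARD('n) - \<alpha>) / 2) / Gamma (real CARD('n) / 2)"
    using dim3 \<alpha> G by (subst nn_integral_std_gaussian_norm_powr) (auto simp: diff_divide_distrib)
  finally have I: "(LINT y|?N. norm y powr (- \<alpha>))
      = 2 powr (- (\<alpha> / 2)) * Gamma ((real CARD('n) - \<alpha>) / 2) / Gamma (real CARD('n) / 2)" .
  have "(sqrt (2 * K) * norm y) powr (- \<alpha>) = 2 powr (- (\<alpha> / 2)) * K powr (- (\<alpha> / 2)) * norm y powr (- \<alpha>)" for y :: "real ^ 'n"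
    using K by (simp add: powr_mult powr_half_sqrt[symmetric] powr_powr del: real_sqrt_mult)
  then have "(LINT y|?N. (sqrt (2 * K) * norm y) powr (- \<alpha>))
      = 2 powr (- (\<alpha> / 2)) * K powr (- (\<alpha> / 2)) * (LINT y|?N. norm y powr (- \<alpha>))"
    by simp
  also have "\<dots> = (2 powr (- (\<alpha> / 2)) * 2 powr (- (\<alpha> / 2))) * Gamma ((real CARD('n) - \<alpha>) / 2) / Gamma (real CARD('n) / 2) * K powr (- (\<alpha> / 2))"
    unfolding I by simp
  also have "2 powr (- (\<alpha> / 2)) * 2 powr (- (\<alpha> / 2)) = (2 powr (- \<alpha>) :: real)"
    by (simp add: powr_add[symmetric])
  finally show ?thesis .
qed

lemma laplace_square_potential_limit:
  assumes dim3: "3 \<le> CARD('n)" and pos: "\<And>u. 0 < u \<Longrightarrow> 0 < \<Psi> u"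
    and \<alpha>: "0 \<le> \<alpha>" "\<alpha> \<le> 2"
    and rv: "\<And>b. 0 < b \<Longrightarrow> ((\<lambda>x. \<Psi> (b * x) / \<Psi> x) \<longlongrightarrow> b powr \<alpha>) at_top"
    and K: "1 \<le> K"
  shows "((\<lambda>s. ennreal (\<Psi> (sqrt s)) * (\<integral>\<^sup>+z. ennreal (exp (- (K * (s * z)))) \<partial>square_potential))
     \<longlongrightarrow> ennreal (2 powr (- \<alpha>) * Gamma ((real CARD('n) - \<alpha>) / 2) / Gamma (real CARD('n) / 2)
            * K powr (- (\<alpha> / 2)))) at_top"
proof -
  let ?N = "std_gaussian :: (real ^ 'n) measure"
  have K0: "0 < K" using K by simp
  have "((\<lambda>s. ennreal (LINT y|?N. \<Psi> (sqrt s) / \<psi> (sqrt (2 * (K * s)) *\<^sub>R y))) \<longlongrightarrow>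
     ennreal (2 powr (- \<alpha>) * Gamma ((real CARD('n) - \<alpha>) / 2) / Gamma (real CARD('n) / 2)
            * K powr (- (\<alpha> / 2)))) at_top"
    using tendsto_ennrealI[OF exponent_ratio_gaussian_limit[OF dim3 pos rv K]]
    unfolding gaussian_limit_value[OF dim3 \<alpha> K0] .
  moreover have "\<forall>\<^sub>F s in at_top. ennreal (LINT y|?N. \<Psi> (sqrt s) / \<psi> (sqrt (2 * (K * s)) *\<^sub>R y))
     = ennreal (\<Psi> (sqrt s)) * (\<integral>\<^sup>+z. ennreal (exp (- (K * (s * z)))) \<partial>square_potential)"
    using eventually_gt_at_top[of 0]
  proof eventually_elim
    case (elim s)
    have nn: "0 \<le> \<Psi> (sqrt s)" using elim by (intro radial_profile_nonneg) simp
    have "ennreal (\<Psi> (sqrt s)) * (\<integral>\<^sup>+z. ennreal (exp (- (K * (s * z)))) \<partial>square_potential)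
        = ennreal (\<Psi> (sqrt s)) * (\<integral>\<^sup>+y. ennreal (1 / \<psi> (sqrt (2 * (K * s)) *\<^sub>R y)) \<partial>?N)"
      using laplace_square_potential[OF pos, of "K * s"] elim K0 by (simp add: mult.assoc)
    also have "\<dots> = (\<integral>\<^sup>+y. ennreal (\<Psi> (sqrt s) / \<psi> (sqrt (2 * (K * s)) *\<^sub>R y)) \<partial>?N)"
      using nn exponent_nonneg
      by (subst nn_integral_cmult[symmetric]) (auto intro!: nn_integral_cong simp: ennreal_mult[symmetric])
    also have "\<dots> = ennreal (LINT y|?N. \<Psi> (sqrt s) / \<psi> (sqrt (2 * (K * s)) *\<^sub>R y))"
    proof (rule nn_integral_eq_integral)
      show "integrable ?N (\<lambda>y. \<Psi> (sqrt s) / \<psi> (sqrt (2 * (K * s)) *\<^sub>R y))"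
      proof (rule Bochner_Integration.integrable_bound[OF integrable_exponent_ratio_bound[OF dim3]])
        show "AE y in ?N. norm (\<Psi> (sqrt s) / \<psi> (sqrt (2 * (K * s)) *\<^sub>R y)) \<le> norm (4 * (1 + norm y powr (- 2)))"
          using AE_std_gaussian_nonzero
        proof eventually_elim
          case (elim y)
          then have "norm (\<Psi> (sqrt s) / \<psi> (sqrt (2 * (K * s)) *\<^sub>R y)) \<le> 4 * (1 + norm y powr (- 2))"
            by (intro exponent_ratio_bound pos \<open>0 < s\<close> K)
          then show ?case by simp
        qed
      qed measurable
    qed (rule AE_I2, rule divide_nonneg_nonneg[OF nn exponent_nonneg])
    finally show ?case by simp
  qed
  ultimately show ?thesis by (rule Lim_transform_eventually)
qed

end

section \<open>Small balls\<close>

theorem theorem9: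
  fixes M :: "'w measure"
    and X :: "real \<Rightarrow> 'w \<Rightarrow> real ^ 'n"
    and \<psi> :: "real ^ 'n \<Rightarrow> real"
    and \<alpha> :: real
  assumes "3 \<le> CARD('n)"
    and "isotropic_unimodal_levy_process M X"
    and "levy_khintchine_exponent M X \<psi>"
    and "0 \<le> \<alpha>" and "\<alpha> \<le> 2"
    and "regularly_varying_at_top \<alpha> (radial_profile \<psi>)"
  shows "((\<lambda>r. ennreal (radial_profile \<psi> (inverse r)) * potential_measure M X {x. norm x \<le> r})
           \<longlongrightarrow> ennreal (2 powr (- \<alpha>) * Gamma ((real CARD('n) - \<alpha>) / 2)
                        / (Gamma (real CARD('n) / 2) * Gamma (1 + \<alpha> / 2)))) (at_right 0)"
proof -
  interpret isotropic_unimodal_levy_process M X by fact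
  interpret isotropic_exponent M X \<psi>
    using assms(1,3) by unfold_locales (auto simp: levy_khintchine_exponent_def)
  obtain x0 where x0: "0 < x0" "\<And>x. x0 \<le> x \<Longrightarrow> 0 < \<Psi> x"
    and rv: "\<And>b. 0 < b \<Longrightarrow> ((\<lambda>x. \<Psi> (b * x) / \<Psi> x) \<longlongrightarrow> b powr \<alpha>) at_top"
    using assms(6) unfolding regularly_varying_at_top_def by blast
  \<comment> \<open>A zero at \<open>u > 0\<close> would, by the growth bound, force the profile to vanish at \<open>x0\<close>.\<close>
  have pos: "0 < \<Psi> u" if u: "0 < u" for u
  proof (rule ccontr)
    assume "\<not> 0 < \<Psi> u"
    then have "\<Psi> u = 0" using radial_profile_nonneg[of u] u by simp
    then show False using radial_profile_growth[OF u, of x0] x0(1) x0(2)[of x0] by simp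
  qed
  define c where "c = 2 powr (- \<alpha>) * Gamma ((real CARD('n) - \<alpha>) / 2) / Gamma (real CARD('n) / 2)"
  have c: "0 \<le> c"
    unfolding c_def using assms(1,4,5)
    by (intro divide_nonneg_nonneg mult_nonneg_nonneg less_imp_le[OF Gamma_real_pos]) auto
  have "((\<lambda>s. ennreal (\<Psi> (sqrt s)) * emeasure square_potential {..1 / s})
      \<longlongrightarrow> ennreal (c / Gamma (1 + \<alpha> / 2))) at_top"
  proof (rule karamata_tauberian)
    show "((\<lambda>s. ennreal (\<Psi> (sqrt s)) * (\<integral>\<^sup>+z. ennreal (exp (- (real (Suc k) * (s * z)))) \<partial>square_potential))
        \<longlongrightarrow> ennreal (c * real (Suc k) powr (- (\<alpha> / 2)))) at_top" for k
      unfolding c_def by (rule laplace_square_potential_limit[OF assms(1) pos assms(4,5) rv]) auto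
  qed (use assms(4) c AE_square_potential_nonneg in auto)
  \<comment> \<open>Small radii \<open>r\<close> correspond to large Laplace parameters \<open>s = 1 / r\<^sup>2\<close>.\<close>
  moreover have "filterlim (\<lambda>r::real. (inverse r)\<^sup>2) at_top (at_right 0)"
    by (intro filterlim_pow_at_top filterlim_inverse_at_top_right) simp
  ultimately have "((\<lambda>r. ennreal (\<Psi> (sqrt ((inverse r)\<^sup>2))) * emeasure square_potential {..1 / (inverse r)\<^sup>2})
      \<longlongrightarrow> ennreal (c / Gamma (1 + \<alpha> / 2))) (at_right 0)"
    by (rule filterlim_compose)
  moreover have "\<forall>\<^sub>F r in at_right 0. ennreal (\<Psi> (sqrt ((inverse r)\<^sup>2))) * emeasure square_potential {..1 / (inverse r)\<^sup>2}
      = ennreal (\<Psi> (inverse r)) * potential_measure M X {x. norm x \<le> r}"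
    using eventually_at_right_less[of "0 :: real"]
  proof eventually_elim
    case (elim r)
    have "sqrt ((inverse r)\<^sup>2) = inverse r" "1 / (inverse r)\<^sup>2 = r\<^sup>2"
      using elim by (simp only: real_sqrt_abs, simp) (simp add: power_inverse divide_inverse)
    then show ?case
      using elim by (simp only: potential_measure_cball less_imp_le)
  qed
  ultimately have "((\<lambda>r. ennreal (\<Psi> (inverse r)) * potential_measure M X {x. norm x \<le> r})
      \<longlongrightarrow> ennreal (c / Gamma (1 + \<alpha> / 2))) (at_right 0)"
    by (rule Lim_transform_eventually)
  then show ?thesis by (simp add: c_def)
qed

end
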